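(* Assume that $0<h<1$, that $2/h$ is not an integer, and that $\lim_{\beta\to\infty}|\Lambda_{L_\beta}|\,e^{-2\beta}=0$. Then $$\lim_{\beta\to\infty}\mathbb P_{\mathbf{-1}}\big[H_{\mathfrak R^l}<H_{\{\mathbf 0,\mathbf{+1}\}}\big]=1,\qquad \lim_{\beta\to\infty}\mathbb P_{\mathbf 0}\big[H_{\mathfrak R^l_0}<H_{\{\mathbf{-1},\mathbf{+1}\}}\big]=1.$$
   Context: Blume–Capel model. Fix $h\in(0,2)$ and let $n_0=\lfloor 2/h\rfloor$. For each $\beta>0$ let $L=L_\beta$ be a positive integer (with $L_\beta\ge n_0(n_0+1)+2$). Let $\mathbb T_L=\{1,\dots,L\}$ be the discrete one-dimensional torus, $\Lambda_L=\mathbb T_L\times\mathbb T_L$ (with the nearest-neighbour structure of the torus), $\Omega_L=\{-1,0,1\}^{\Lambda_L}$. The Hamiltonian is $\mathbb H(\sigma)=\sum(\sigma(y)-\sigma(x))^2-h\sum_{x\in\Lambda_L}\sigma(x)$, the first sum over unordered nearest-neighbour pairs $\{x,y\}$. For $x\in\Lambda_L$, $\sigma^{x,\pm}$ is the configuration obtained from $\sigma$ by replacing $\sigma(x)$ by $\sigma(x)\pm1$ taken modulo $3$ in $\{-1,0,1\}$. The process $(\sigma_t)_{t\ge0}$ is the continuous-time Markov chain on $\Omega_L$ jumping from $\sigma$ to $\sigma^{x,\pm}$ at rate $R_\beta(\sigma,\sigma^{x,\pm})=\exp\{-\beta[\mathbb H(\sigma^{x,\pm})-\mathbb H(\sigma)]_+\}$.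 $\mathbb P_\sigma$ denotes its law starting from $\sigma$. For $A\subset\Omega_L$, $H_A=\inf\{t>0:\sigma_t\in A\}$; $H_\sigma=H_{\{\sigma\}}$. $\mathbf{-1},\mathbf 0,\mathbf{+1}$ are the configurations with all spins equal to $-1,0,+1$. An $n_0\times(n_0+1)$-rectangle means a set of sites of $\Lambda_L$ forming a rectangle with side lengths $n_0$ and $n_0+1$ (in either orientation). $\mathfrak R^l$ is the set of configurations $\sigma$ such that $\sigma=0$ on $Q\cup\{z\}$ and $\sigma=-1$ elsewhere, where $Q$ is an $n_0\times(n_0+1)$-rectangle and $z\notin Q$ is a nearest neighbour of a site of $Q$ lying on one of the two sides of $Q$ of length $n_0+1$ (the extra $0$-spin is attached to a longest side). $\mathfrak R^l_0$ is defined identically with the background value $-1$ replaced by $0$ and the value $0$ on $Q\cup\{z\}$ replaced by $+1$. *)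

theory Defs
  imports "HOL-Analysis.Analysis"
begin

type_synonym site = "nat \<times> nat"
type_synonym config = "site \<Rightarrow> int"

definition sites :: "nat \<Rightarrow> site set" where
  "sites L = {0..<L} \<times> {0..<L}"

definition configs :: "nat \<Rightarrow> config set" where
  "configs L = {\<sigma>. (\<forall>x\<in>sites L. \<sigma> x \<in> {-1,0,1}) \<and> (\<forall>x. x \<notin> sites L \<longrightarrow> \<sigma> x = 0)}"

definition const_cfg :: "nat \<Rightarrow> int \<Rightarrow> config" where
  "const_cfg L c = (\<lambda>x. if x \<in> sites L then c else 0)"

definition right_nb :: "nat \<Rightarrow> site \<Rightarrow> site" where
  "right_nb L x = ((fst x + 1) mod L, snd x)"

definition up_nb :: "nat \<Rightarrow> site \<Rightarrow> site" where
  "up_nb L x = (fst x, (snd x + 1) mod L)"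

text \<open>Hamiltonian; each unordered nearest-neighbour pair of the torus is
  {x, right x} or {x, up x} for exactly one (x, direction) when L >= 3.\<close>
definition Ham :: "nat \<Rightarrow> real \<Rightarrow> config \<Rightarrow> real" where
  "Ham L h \<sigma> =
     (\<Sum>x\<in>sites L. real_of_int ((\<sigma> (right_nb L x) - \<sigma> x)^2)
                   + real_of_int ((\<sigma> (up_nb L x) - \<sigma> x)^2))
     - h * (\<Sum>x\<in>sites L. real_of_int (\<sigma> x))"

definition succ3 :: "int \<Rightarrow> int" where
  "succ3 v = (if v = 1 then -1 else v + 1)"

definition pred3 :: "int \<Rightarrow> int" where
  "pred3 v = (if v = -1 then 1 else v - 1)"

definition flip :: "bool \<Rightarrow> site \<Rightarrow> config \<Rightarrow> config" where
  "flip s x \<sigma> = \<sigma>(x := (if s then succ3 (\<sigma> x) else pred3 (\<sigma> x)))"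

definition rate :: "nat \<Rightarrow> real \<Rightarrow> real \<Rightarrow> config \<Rightarrow> config \<Rightarrow> real" where
  "rate L h \<beta> \<sigma> \<eta> = exp (- \<beta> * max 0 (Ham L h \<eta> - Ham L h \<sigma>))"

definition totrate :: "nat \<Rightarrow> real \<Rightarrow> real \<Rightarrow> config \<Rightarrow> real" where
  "totrate L h \<beta> \<sigma> = (\<Sum>x\<in>sites L. \<Sum>s\<in>(UNIV::bool set). rate L h \<beta> \<sigma> (flip s x \<sigma>))"

text \<open>hit_within L h beta A B n sigma: probability, for the chain started at sigma,
  that among the first n jumps some jump lands in A and no earlier jump (after time 0)
  landed in B.  (The continuous-time chain and its embedded jump chain visit the
  same sequence of states.)\<close>
primrec hit_within :: "nat \<Rightarrow> real \<Rightarrow> real \<Rightarrow> config set \<Rightarrow> config set \<Rightarrow> nat \<Rightarrow> config \<Rightarrow> real" where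
  "hit_within L h \<beta> A B 0 \<sigma> = 0"
| "hit_within L h \<beta> A B (Suc n) \<sigma> =
     (\<Sum>x\<in>sites L. \<Sum>s\<in>(UNIV::bool set).
        rate L h \<beta> \<sigma> (flip s x \<sigma>) / totrate L h \<beta> \<sigma> *
        (if flip s x \<sigma> \<in> A then 1
         else if flip s x \<sigma> \<in> B then 0
         else hit_within L h \<beta> A B n (flip s x \<sigma>)))"

text \<open>P_sigma[H_A < H_B] (with H = inf{t > 0 : ...}).\<close>
definition hit_before :: "nat \<Rightarrow> real \<Rightarrow> real \<Rightarrow> config set \<Rightarrow> config set \<Rightarrow> config \<Rightarrow> real" where
  "hit_before L h \<beta> A B \<sigma> = (SUP n. hit_within L h \<beta> A B n \<sigma>)"

definition rect :: "nat \<Rightarrow> nat \<Rightarrow> nat \<Rightarrow> nat \<Rightarrow> nat \<Rightarrow> site set" where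
  "rect L a b w ht = {((a + i) mod L, (b + j) mod L) | i j. i < w \<and> j < ht}"

definition long_side_nbrs :: "nat \<Rightarrow> nat \<Rightarrow> nat \<Rightarrow> nat \<Rightarrow> nat \<Rightarrow> site set" where
  "long_side_nbrs L a b w ht =
     (if ht < w then
        {((a + i) mod L, (b + L - 1) mod L) | i. i < w} \<union> {((a + i) mod L, (b + ht) mod L) | i. i < w}
      else
        {((a + L - 1) mod L, (b + j) mod L) | j. j < ht} \<union> {((a + w) mod L, (b + j) mod L) | j. j < ht})"

definition Rl_gen :: "nat \<Rightarrow> nat \<Rightarrow> int \<Rightarrow> int \<Rightarrow> config set" where
  "Rl_gen L n0 bg fg = {\<sigma>. \<exists>a b w ht z. a < L \<and> b < L \<and>
       ((w = n0 \<and> ht = n0 + 1) \<or> (w = n0 + 1 \<and> ht = n0)) \<and>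
       z \<in> long_side_nbrs L a b w ht \<and> z \<notin> rect L a b w ht \<and>
       \<sigma> = (\<lambda>x. if x \<in> sites L then (if x \<in> rect L a b w ht \<union> {z} then fg else bg) else 0)}"

definition Rl :: "nat \<Rightarrow> nat \<Rightarrow> config set" where
  "Rl L n0 = Rl_gen L n0 (-1) 0"

definition Rl0 :: "nat \<Rightarrow> nat \<Rightarrow> config set" where
  "Rl0 L n0 = Rl_gen L n0 0 1"

definition n0_of :: "real \<Rightarrow> nat" where
  "n0_of h = nat \<lfloor>2 / h\<rfloor>"

end

theory Submission
  imports Defs "HOL-Number_Theory.Cong" "HOL-Real_Asymp.Real_Asymp"
begin

text \<open>Let \<open>\<phi>\<close> be the probability of missing the critical droplets, cut off to \<open>0\<close> outside a set \<open>S\<close> of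
  subcritical configurations. Summation by parts bounds its Dirichlet form by the conductance of the
  edges that leave \<open>S\<close> without entering a critical droplet, while \<open>|\<Lambda>|\<close> edge-disjoint paths from the
  background to the critical droplets, one for each translation, bound it from below.

  The point is the choice of \<open>S\<close>: the set of sites off the background has at most \<open>n\<^sub>0(n\<^sub>0+1)\<close> elements,
  or its two projections have at most \<open>n\<^sub>0\<close> and \<open>n\<^sub>0 + 2\<close> elements. The second alternative absorbs the growth
  of an \<open>n\<^sub>0 \<times> (n\<^sub>0+1)\<close> rectangle along a shortest side, which costs no more energy than along a longest one.
  An edge leaving \<open>S\<close> elsewhere than through a critical droplet is more expensive by a fixed
  amount if its configuration is covered by one ball, and by \<open>2(k-1)\<close> if \<open>k \<ge> 2\<close> balls are needed. As
  there are \<open>O(|\<Lambda>|^k)\<close> such edges, they are negligible when \<open>|\<Lambda>| exp(-2\<beta>) \<longlongrightarrow> 0\<close>.\<close>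

subsection \<open>Perimeters on the torus\<close>

text \<open>The obstacle is entropy. A single path to the droplets would only give a bound of order
  |\<Lambda>| exp(-\<beta>\<delta>) with \<delta> = \<open>min h (2 - h * real n)\<close> < 1, which
  the hypothesis does not control. The |\<Lambda>| disjoint paths supply the missing factor
  1/|\<Lambda>|: k balls can be placed in |\<Lambda>|^k ways, and after division the term for k >= 2
  is (|\<Lambda>| exp(-2\<beta>))^(k-1), while the term for one ball is of order
  exp(-\<beta>\<delta>). The price 2(k-1) is isoperimetric: at the volumes in question each further
  component forces one more unit of half perimeter, worth energy 2. In \<delta>, the entry h is the
  price of reaching n(n+1) sites with the half perimeter 2n+2 of the droplet, or of a spin that is
  neither the background value nor the next one; 2 - hn is the price of sticking out of an n by n+2
  box. It is positive because 2/h is not an integer. The cut-off confines the estimate to S, so that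
  nothing has to be known about the energy landscape beyond it.\<close>

definition exits :: "('a \<Rightarrow> 'a) \<Rightarrow> 'a set \<Rightarrow> nat" where
  "exits f V = card {x \<in> V. f x \<notin> V}"

text \<open>On a cycle a set is left as often as it is entered, so the exits to the right and upwards make up
  half of the boundary edges.\<close>
definition half_per :: "nat \<Rightarrow> site set \<Rightarrow> nat" where
  "half_per L V = exits (right_nb L) V + exits (up_nb L) V"

definition cyc :: "nat \<Rightarrow> nat \<Rightarrow> nat \<Rightarrow> nat set" where
  "cyc L a w = {(a + i) mod L | i. i < w}"

lemma finite_sites [simp]: "finite (sites L)"
  by (simp add: sites_def)

lemma card_sites [simp]: "card (sites L) = L * L"
  by (simp add: sites_def)

lemma right_nb_sites: "x \<in> sites L \<Longrightarrow> right_nb L x \<in> sites L"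
  by (auto simp: sites_def right_nb_def)

lemma up_nb_sites: "x \<in> sites L \<Longrightarrow> up_nb L x \<in> sites L"
  by (auto simp: sites_def up_nb_def)

lemma Suc_mod_inj: "a < L \<Longrightarrow> b < L \<Longrightarrow> Suc a mod L = Suc b mod L \<Longrightarrow> a = (b::nat)"
  by (metis Suc_lessI mod_Suc mod_less nat.inject nat.distinct(1))

lemma inj_right_nb: "inj_on (right_nb L) (sites L)"
  by (auto simp: inj_on_def sites_def right_nb_def dest: Suc_mod_inj)

lemma inj_up_nb: "inj_on (up_nb L) (sites L)"
  by (auto simp: inj_on_def sites_def up_nb_def dest: Suc_mod_inj)

text \<open>\<open>f\<close> permutes \<open>S\<close>, so the preimage of \<open>V\<close> has as
  many elements as \<open>V\<close>; removing the common part leaves the entering sites on one side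
  and the exits on the other.\<close>

lemma exits_converse:
  assumes "finite S" "inj_on f S" "f ` S \<subseteq> S" "V \<subseteq> S"
  shows "card {x \<in> S. x \<notin> V \<and> f x \<in> V} = exits f V"
proof -
  have surj: "f ` S = S"
    using assms by (simp add: endo_inj_surj)
  define P where "P = {x \<in> S. f x \<in> V}"
  have fin: "finite V" "finite P"
    using assms by (auto simp: P_def intro: finite_subset)
  have "f ` P = V"
    using surj assms(4) by (auto simp: P_def)
  moreover have "inj_on f P"
    using assms(2) by (auto simp: P_def inj_on_def)
  ultimately have "card P = card V"
    by (metis card_image)
  moreover have "card P = card (P \<inter> V) + card (P - V)" "card V = card (P \<inter> V) + card (V - P)"
    using fin by (metis Int_commute card_Diff_subset_Int card_mono finite_Int inf_le1 le_add_diff_inverse)+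
  moreover have "P - V = {x \<in> S. x \<notin> V \<and> f x \<in> V}" "V - P = {x \<in> V. f x \<notin> V}"
    using assms(4) by (auto simp: P_def)
  ultimately show ?thesis
    by (simp add: exits_def)
qed

lemma sum_indicator_subset:
  "finite S \<Longrightarrow> B \<subseteq> S \<Longrightarrow> (\<Sum>x\<in>S. indicator B x :: real) = real (card B)"
  by (simp add: indicator_def of_bool_def sum.If_cases Int_absorb1)

text \<open>Crossings outwards and inwards each contribute 1 and are equally many. This links the
  quadratic part of \<open>Ham\<close> to perimeters.\<close>

lemma sum_indicator_diff_exits:
  assumes "finite S" "inj_on f S" "f ` S \<subseteq> S" "V \<subseteq> S"
  shows "(\<Sum>x\<in>S. ((indicator V (f x) - indicator V x)\<^sup>2 :: real)) = 2 * real (exits f V)"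
proof -
  have fin: "finite V" using assms finite_subset by blast
  have "(\<Sum>x\<in>S. ((indicator V (f x) - indicator V x)\<^sup>2 :: real))
      = (\<Sum>x\<in>S. indicator {x \<in> S. x \<notin> V \<and> f x \<in> V} x + indicator {x \<in> V. f x \<notin> V} x)"
    by (rule sum.cong) (auto simp: indicator_def)
  also have "\<dots> = real (card {x \<in> S. x \<notin> V \<and> f x \<in> V}) + real (card {x \<in> V. f x \<notin> V})"
    using assms(1,4) by (subst sum.distrib, subst (1 2) sum_indicator_subset) auto
  finally show ?thesis
    using exits_converse[OF assms] by (simp add: exits_def)
qed

text \<open>Otherwise \<open>A\<close> would be closed under the successor, and going around from
  one element would reach the whole cycle.\<close>

lemma cyc_exit_exists:
  assumes "A \<subseteq> {0..<L}" "A \<noteq> {}" "card A < L"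
  shows "\<exists>x\<in>A. Suc x mod L \<notin> A"
proof (rule ccontr)
  assume "\<not> ?thesis"
  then have step: "\<And>x. x \<in> A \<Longrightarrow> Suc x mod L \<in> A" by blast
  obtain x where x: "x \<in> A" using assms by blast
  have xL: "x < L" using x assms by auto
  have all: "(x + n) mod L \<in> A" for n
  proof (induction n)
    case 0 then show ?case using x xL by simp
  next
    case (Suc n) then show ?case using step[OF Suc] by (simp add: mod_Suc_eq)
  qed
  have "y \<in> A" if "y < L" for y
  proof -
    have "(x + (L - x + y)) mod L = y" using xL that by simp
    then show ?thesis using all by metis
  qed
  then have "{0..<L} \<subseteq> A" by auto
  then have "card {0..<L} \<le> card A"
    using assms(1) by (meson card_mono finite_atLeastLessThan finite_subset)
  then show False using assms(3) by simp
qed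

text \<open>Every column met by \<open>V\<close> contributes an exit of its own: the bound on the
  second projection prevents the column from being full.\<close>

lemma exits_up_ge:
  assumes "V \<subseteq> sites L" "card (snd ` V) < L"
  shows "card (fst ` V) \<le> exits (up_nb L) V"
proof -
  have fin: "finite V" using assms(1) finite_subset finite_sites by blast
  have "fst ` V \<subseteq> fst ` {x \<in> V. up_nb L x \<notin> V}"
  proof
    fix a assume "a \<in> fst ` V"
    define A where "A = {b. (a, b) \<in> V}"
    have "A \<subseteq> snd ` V" by (force simp: A_def)
    then have "card A < L" using fin assms(2) by (meson card_mono finite_imageI le_less_trans)
    moreover have "A \<subseteq> {0..<L}" "A \<noteq> {}"
      using assms(1) \<open>a \<in> fst ` V\<close> by (auto simp: A_def sites_def)
    ultimately obtain b where "b \<in> A" "Suc b mod L \<notin> A"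
      using cyc_exit_exists by blast
    then have "(a, b) \<in> {x \<in> V. up_nb L x \<notin> V}"
      by (auto simp: A_def up_nb_def)
    then show "a \<in> fst ` {x \<in> V. up_nb L x \<notin> V}" by force
  qed
  then have "card (fst ` V) \<le> card (fst ` {x \<in> V. up_nb L x \<notin> V})"
    using fin by (simp add: card_mono)
  also have "\<dots> \<le> exits (up_nb L) V"
    unfolding exits_def using fin by (simp add: card_image_le)
  finally show ?thesis .
qed

lemma exits_swap: "exits (right_nb L) (prod.swap ` V) = exits (up_nb L) V"
proof -
  have "{x \<in> prod.swap ` V. right_nb L x \<notin> prod.swap ` V} = prod.swap ` {x \<in> V. up_nb L x \<notin> V}"
    by (force simp: right_nb_def up_nb_def)
  then show ?thesis by (simp add: exits_def card_image)
qed

lemma exits_swap': "exits (up_nb L) (prod.swap ` V) = exits (right_nb L) V"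
  using exits_swap[of L "prod.swap ` V"] by (simp add: image_comp)

lemma swap_sites: "V \<subseteq> sites L \<Longrightarrow> prod.swap ` V \<subseteq> sites L"
  by (auto simp: sites_def)

lemma exits_right_ge:
  assumes "V \<subseteq> sites L" "card (fst ` V) < L"
  shows "card (snd ` V) \<le> exits (right_nb L) V"
  using exits_up_ge[OF swap_sites[OF assms(1)]] assms(2) exits_swap'[of L V]
  by (simp add: image_image)

lemma half_per_ge:
  assumes "V \<subseteq> sites L" "card (fst ` V) < L" "card (snd ` V) < L"
  shows "card (fst ` V) + card (snd ` V) \<le> half_per L V"
  using exits_up_ge[OF assms(1,3)] exits_right_ge[OF assms(1,2)] unfolding half_per_def by simp

lemma card_le_proj: "finite V \<Longrightarrow> card V \<le> card (fst ` V) * card (snd ` V)"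
  by (metis card_cartesian_product card_mono finite_SigmaI finite_imageI subset_fst_snd)

text \<open>The isoperimetric inequality: \<open>V\<close> lies in the product of its projections,
  and the inequality of arithmetic and geometric means compares the area of that box with its half
  perimeter.\<close>

lemma card_le_half_per_sq:
  assumes "V \<subseteq> sites L" "card (fst ` V) < L" "card (snd ` V) < L"
  shows "4 * card V \<le> (half_per L V)\<^sup>2"
proof -
  have "finite V" using assms(1) finite_subset finite_sites by blast
  let ?p = "card (fst ` V)" and ?q = "card (snd ` V)"
  have "4 * card V \<le> 4 * (?p * ?q)" using card_le_proj[OF \<open>finite V\<close>] by simp
  also have "int (4 * (?p * ?q)) \<le> int ((?p + ?q)\<^sup>2)"
    using sum_squares_ge_zero[of "int ?p - int ?q" 0] by (simp add: power2_eq_square algebra_simps)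
  then have "4 * (?p * ?q) \<le> (?p + ?q)\<^sup>2" by linarith
  also have "\<dots> \<le> (half_per L V)\<^sup>2" using half_per_ge[OF assms] by (rule power_mono) simp
  finally show ?thesis .
qed

subsection \<open>Cyclic intervals and rectangles\<close>

lemma card_cyc: "w \<le> L \<Longrightarrow> card (cyc L a w) = w"
proof -
  assume w: "w \<le> L"
  have "inj_on (\<lambda>i. (a + i) mod L) {..<w}"
  proof (rule inj_onI)
    fix i j assume "i \<in> {..<w}" "j \<in> {..<w}" and e: "(a + i) mod L = (a + j) mod L"
    then have "i < L" "j < L" using w by auto
    moreover have "[i = j] (mod L)"
      using e by (simp add: cong_def[symmetric] cong_add_lcancel_nat)
    ultimately show "i = j" by (simp add: cong_def)
  qed
  moreover have "cyc L a w = (\<lambda>i. (a + i) mod L) ` {..<w}" by (auto simp: cyc_def)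
  ultimately show ?thesis by (simp add: card_image)
qed

lemma rect_cyc: "rect L a b w ht = cyc L a w \<times> cyc L b ht"
  by (auto simp: rect_def cyc_def)

text \<open>Every element of \<open>A\<close> other than the exit \<open>z\<close> has its successor
  in \<open>A\<close>. Hence the backward distances from \<open>z\<close> that lead into
  \<open>A\<close> are closed downwards, and \<open>A\<close> is a run ending at
  \<open>z\<close>.\<close>

lemma cyc_of_single_exit:
  assumes A: "A \<subseteq> {0..<L}" and one: "card {x \<in> A. Suc x mod L \<notin> A} = 1"
  shows "\<exists>a<L. A = cyc L a (card A)"
proof -
  obtain z where z: "{x \<in> A. Suc x mod L \<notin> A} = {z}"
    using one card_1_singletonE by blast
  have zA: "z \<in> A" and zL: "z < L" using z A by auto
  have step: "Suc x mod L \<in> A" if "x \<in> A" "x \<noteq> z" for x using that z by blast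
  \<comment> \<open>Distances are counted backwards from \<open>z\<close>; adding \<open>L\<close>
    keeps the subtraction of naturals from being truncated.\<close>
  define D where "D = {d. d < L \<and> (z + L - d) mod L \<in> A}"
  have down: "d \<in> D" if "Suc d \<in> D" for d
  proof -
    let ?x = "(z + L - Suc d) mod L"
    have d: "Suc d < L" "?x \<in> A" using that by (auto simp: D_def)
    have "?x \<noteq> z"
    proof
      assume "?x = z"
      then have "[z + L - Suc d = z] (mod L)" using zL by (simp add: cong_def)
      then have "[z + L - Suc d + Suc d = z + Suc d] (mod L)" by (rule cong_add) simp
      then have "[z = z + Suc d] (mod L)" using d by (simp add: cong_def)
      then have "[0 = Suc d] (mod L)" by (metis add.right_neutral cong_add_lcancel_nat)
      then show False using d by (simp add: cong_def)
    qed
    then have "Suc ?x mod L \<in> A" using step d by blast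
    moreover have "Suc ?x mod L = (z + L - d) mod L"
      using d by (simp add: mod_Suc_eq) (metis Suc_diff_Suc Suc_lessD less_imp_le_nat less_le_trans trans_less_add2)
    ultimately show ?thesis using d by (simp add: D_def)
  qed
  have down_le: "d' \<in> D" if "d \<in> D" "d' \<le> d" for d d'
    using that(2,1) by (induction rule: inc_induct) (auto intro: down)
  have finD: "finite D" by (auto simp: D_def)
  have D_eq: "D = {..<card D}"
  proof (cases "D = {}")
    case False
    then have "Max D \<in> D" using finD by simp
    then have "D = {..Max D}" using down_le Max_ge[OF finD] by (meson atMost_iff subset_antisym subsetI)
    then show ?thesis by (metis card_atMost lessThan_Suc_atMost)
  qed simp
  have img: "(\<lambda>d. (z + L - d) mod L) ` D = A"
  proof
    show "A \<subseteq> (\<lambda>d. (z + L - d) mod L) ` D"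
    proof
      fix y assume y: "y \<in> A"
      then have yL: "y < L" using A by auto
      define d where "d = (z + L - y) mod L"
      have "(z + L - d) mod L = y"
      proof (cases "y \<le> z")
        case True
        then have "z + L - y = (z - y) + L" by simp
        then have "d = (z - y) mod L" unfolding d_def by (metis mod_add_self2)
        then have "d = z - y" using zL by simp
        then have "z + L - d = L + y" using True by simp
        then show ?thesis using yL by simp
      next
        case False
        then have "d = z + L - y" using yL unfolding d_def by simp
        then have "z + L - d = y" using False yL by simp
        then show ?thesis using yL by simp
      qed
      moreover have "d < L" using zL by (simp add: d_def)
      ultimately show "y \<in> (\<lambda>d. (z + L - d) mod L) ` D" using y by (force simp: D_def)
    qed
  qed (auto simp: D_def)
  have "inj_on (\<lambda>d. (z + L - d) mod L) D"
  proof (rule inj_onI)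
    fix d d' assume d: "d \<in> D" "d' \<in> D" and e: "(z + L - d) mod L = (z + L - d') mod L"
    have "[z + L - d + (d + d') = z + L - d' + (d + d')] (mod L)"
      using e by (intro cong_add) (auto simp: cong_def)
    then have "[z + (L + d') = z + (L + d)] (mod L)" using d by (simp add: D_def)
    then have "[d' = d] (mod L)" by (simp add: cong_add_lcancel_nat)
    then show "d = d'" using d by (simp add: cong_def D_def)
  qed
  then have cA: "card D = card A" using img card_image by metis
  then have wL: "card A \<le> L" using D_eq zL A by (metis card_mono finite_atLeastLessThan card_atLeastLessThan diff_zero)
  have w0: "card A > 0" using zA A finite_subset card_gt_0_iff by fastforce
  \<comment> \<open>The element farthest behind the exit. Distance 0 is \<open>z\<close> itself,
    hence the \<open>- 1\<close>.\<close>
  define a where "a = (z + L - (card A - 1)) mod L"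
  have "A = cyc L a (card A)"
  proof (rule sym, rule card_subset_eq)
    show "finite A" using A finite_subset by auto
    show "cyc L a (card A) \<subseteq> A"
    proof
      fix y assume "y \<in> cyc L a (card A)"
      then obtain i where i: "i < card A" "y = (a + i) mod L" by (auto simp: cyc_def)
      then have "y = (z + L - (card A - 1) + i) mod L" by (simp add: a_def mod_add_left_eq)
      also have "z + L - (card A - 1) + i = z + L - (card A - 1 - i)" using i wL by simp
      finally have "y = (z + L - (card A - 1 - i)) mod L" .
      moreover have "card A - 1 - i \<in> D" using D_eq cA i by auto
      ultimately show "y \<in> A" using img by blast
    qed
    show "card (cyc L a (card A)) = card A" using card_cyc[OF wL] .
  qed
  moreover have "a < L" using zL by (simp add: a_def)
  ultimately show ?thesis by blast
qed

text \<open>Leaves room for boxes of side up to \<open>n + 3\<close> that do not wrap around the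
  torus.\<close>

lemma torus_large: "2 \<le> n \<Longrightarrow> n * (n + 1) + 2 \<le> L \<Longrightarrow> n + 4 < (L::nat)"
proof -
  assume n: "2 \<le> n" and L: "n * (n + 1) + 2 \<le> L"
  have "2 * (n + 1) \<le> n * (n + 1)" using n by (rule mult_le_mono1)
  also have "\<dots> \<le> L - 2" using L by linarith
  finally show "n + 4 < L" using n by arith
qed

lemma exits_right_product:
  "exits (right_nb L) (R \<times> C) = card {x \<in> R. Suc x mod L \<notin> R} * card C"
proof -
  have "{x \<in> R \<times> C. right_nb L x \<notin> R \<times> C} = {x \<in> R. Suc x mod L \<notin> R} \<times> C"
    by (auto simp: right_nb_def)
  then show ?thesis by (simp only: exits_def card_cartesian_product)
qed

lemma exits_up_product:
  "exits (up_nb L) (R \<times> C) = card R * card {x \<in> C. Suc x mod L \<notin> C}"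
proof -
  have "{x \<in> R \<times> C. up_nb L x \<notin> R \<times> C} = R \<times> {x \<in> C. Suc x mod L \<notin> C}"
    by (auto simp: up_nb_def)
  then show ?thesis by (simp only: exits_def card_cartesian_product)
qed

text \<open>This volume and half perimeter leave no slack in the isoperimetric chain: the
  projections must have sizes \<open>n\<close> and \<open>n + 1\<close>, \<open>V\<close> must fill
  their product, and each projection has a single exit and so is a cyclic interval.\<close>

lemma rect_of_small_half_per:
  assumes V: "V \<subseteq> sites L" and n: "2 \<le> n" and L: "n * (n + 1) < L"
    and cV: "card V = n * (n + 1)" and hp: "half_per L V \<le> 2 * n + 1"
  shows "\<exists>a b w ht. a < L \<and> b < L \<and> (w = n \<and> ht = n + 1 \<or> w = n + 1 \<and> ht = n)
           \<and> V = cyc L a w \<times> cyc L b ht"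
proof -
  have fin: "finite V" using V finite_subset finite_sites by blast
  let ?R = "fst ` V" and ?C = "snd ` V"
  let ?p = "card ?R" and ?q = "card ?C"
  have pL: "?p < L" "?q < L" using card_image_le[OF fin, of fst] card_image_le[OF fin, of snd] cV L by auto
  have pq: "?p + ?q \<le> 2 * n + 1" using half_per_ge[OF V pL] hp by simp
  have prod: "n * (n + 1) \<le> ?p * ?q" using card_le_proj[OF fin] cV by simp
  have cases: "?p = n \<and> ?q = n + 1 \<or> ?p = n + 1 \<and> ?q = n"
  proof -
    \<comment> \<open>As 4n(n+1) = (2n+1)^2 - 1, the lower bound on the product leaves
      \<open>?p\<close> and \<open>?q\<close> at most 1 apart; a sum of at most 2n would give a
      product of at most n^2.\<close>
    have "4 * (int ?p * int ?q) = (int ?p + int ?q)\<^sup>2 - (int ?p - int ?q)\<^sup>2"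
      by (simp add: power2_eq_square algebra_simps)
    moreover have "(int ?p + int ?q)\<^sup>2 \<le> (2 * int n + 1)\<^sup>2" using pq by (intro power_mono) auto
    moreover have "int n * (int n + 1) \<le> int ?p * int ?q"
      using of_nat_mono[OF prod, where 'a=int] by (simp add: algebra_simps)
    ultimately have "4 * (int n * (int n + 1)) \<le> (2 * int n + 1)\<^sup>2 - (int ?p - int ?q)\<^sup>2" by linarith
    then have "(int ?p - int ?q)\<^sup>2 \<le> 1" by (simp add: power2_eq_square algebra_simps)
    then have "\<bar>int ?p - int ?q\<bar> \<le> 1" by (metis abs_1 abs_le_square_iff one_power2)
    moreover have "2 * n < ?p + ?q"
    proof (rule ccontr)
      assume "\<not> ?thesis"
      then have "(int ?p + int ?q)\<^sup>2 \<le> (2 * int n)\<^sup>2" by (intro power_mono) auto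
      moreover have "(0::int) \<le> (int ?p - int ?q)\<^sup>2" by simp
      ultimately have "4 * (int n * (int n + 1)) \<le> (2 * int n)\<^sup>2"
        using \<open>4 * (int ?p * int ?q) = _\<close> \<open>int n * (int n + 1) \<le> _\<close> by linarith
      then show False using n by (simp add: power2_eq_square algebra_simps)
    qed
    ultimately show ?thesis using pq by linarith
  qed
  have VRC: "V = ?R \<times> ?C"
    by (rule card_subset_eq) (use fin cases cV in \<open>auto simp: card_cartesian_product subset_fst_snd mult.commute\<close>)
  have sub: "?R \<subseteq> {0..<L}" "?C \<subseteq> {0..<L}" using V by (auto simp: sites_def)
  define er ec where "er = card {x \<in> ?R. Suc x mod L \<notin> ?R}" and "ec = card {x \<in> ?C. Suc x mod L \<notin> ?C}"
  have 1: "exits (right_nb L) V = er * ?q"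
    unfolding er_def by (rule trans[OF arg_cong[OF VRC, of "exits (right_nb L)"] exits_right_product])
  have 2: "exits (up_nb L) V = ?p * ec"
    unfolding ec_def by (rule trans[OF arg_cong[OF VRC, of "exits (up_nb L)"] exits_up_product])
  have "?R \<noteq> {}" "?C \<noteq> {}" using cases n by (metis add_is_0 card.empty not_numeral_le_zero one_neq_zero)+
  then have "{x \<in> ?R. Suc x mod L \<notin> ?R} \<noteq> {}" "{x \<in> ?C. Suc x mod L \<notin> ?C} \<noteq> {}"
    using cyc_exit_exists[OF sub(1) _ pL(1)] cyc_exit_exists[OF sub(2) _ pL(2)] by blast+
  then have ge: "er \<ge> 1" "ec \<ge> 1"
    using fin unfolding er_def ec_def by (simp_all add: Suc_le_eq card_gt_0_iff)
  have le: "er * ?q + ?p * ec \<le> 2 * n + 1" using hp 1 2 unfolding half_per_def by simp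
  \<comment> \<open>A second exit of one projection is repeated along the whole other projection,
    which adds at least \<open>n\<close> to the half perimeter.\<close>
  have "er = 1"
  proof (rule ccontr)
    assume "er \<noteq> 1"
    then have "2 * ?q \<le> er * ?q" "?p \<le> ?p * ec" using ge by auto
    then have "2 * ?q + ?p \<le> 2 * n + 1" using le by linarith
    then show False using cases n by linarith
  qed
  moreover have "ec = 1"
  proof (rule ccontr)
    assume "ec \<noteq> 1"
    then have "?p * 2 \<le> ?p * ec" "?q \<le> er * ?q" using ge by (intro mult_le_mono2, simp_all)
    then have "?q + 2 * ?p \<le> 2 * n + 1" using le by linarith
    then show False using cases n by linarith
  qed
  ultimately obtain a b where "a < L" "?R = cyc L a ?p" "b < L" "?C = cyc L b ?q"
    using cyc_of_single_exit[OF sub(1)] cyc_of_single_exit[OF sub(2)] unfolding er_def ec_def by blast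
  then show ?thesis using VRC cases by metis
qed

section \<open>Subcritical sets and the shape of the critical droplets\<close>

definition small_box :: "nat \<Rightarrow> site set \<Rightarrow> bool" where
  "small_box n V \<longleftrightarrow> card (fst ` V) \<le> n \<and> card (snd ` V) \<le> n + 2
                 \<or> card (fst ` V) \<le> n + 2 \<and> card (snd ` V) \<le> n"

text \<open>Both alternatives pass to subsets, so this class can be left only by adding a
  site.\<close>

definition subcritical :: "nat \<Rightarrow> site set \<Rightarrow> bool" where
  "subcritical n V \<longleftrightarrow> card V \<le> n * (n + 1) \<or> small_box n V"

lemma small_box_mono:
  assumes "V \<subseteq> W" "finite W" "small_box n W" shows "small_box n V"
proof -
  have "card (f ` V) \<le> card (f ` W)" for f :: "site \<Rightarrow> nat"
    using assms by (simp add: card_mono image_mono)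
  then show ?thesis using assms(3) unfolding small_box_def by (meson le_trans)
qed

lemma subcritical_mono:
  assumes "V \<subseteq> W" "finite W" "subcritical n W" shows "subcritical n V"
  using assms small_box_mono card_mono[OF assms(2,1)] unfolding subcritical_def by (meson le_trans)

lemma cyc_finite [simp]: "finite (cyc L a w)"
  unfolding cyc_def by simp

text \<open>The right exits of the rectangle already number one per row, so an additional exit in the row of
  the new site would contradict the bound; hence the new site touches an end of that row.\<close>
lemma attached_horizontally:
  assumes w: "0 < w" "w < L" and C: "finite C" and z: "z1 < L" "z1 \<notin> cyc L a w" "z2 \<in> C"
    and ex: "exits (right_nb L) (insert (z1, z2) (cyc L a w \<times> C)) \<le> card C"
  shows "z1 = (a + w) mod L \<or> z1 = (a + L - 1) mod L"
proof (rule ccontr)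
  assume neg: "\<not> ?thesis"
  let ?R = "cyc L a w" and ?W = "insert (z1, z2) (cyc L a w \<times> C)"
  define l where "l = (a + (w - 1)) mod L"
  have lR: "l \<in> ?R" unfolding l_def cyc_def using w by (intro CollectI exI[of _ "w - 1"]) simp
  have sl: "Suc l mod L = (a + w) mod L" using w by (simp add: l_def mod_Suc_eq)
  have "(a + w) mod L \<notin> ?R"
  proof
    assume "(a + w) mod L \<in> ?R"
    then obtain i where i: "i < w" "(a + w) mod L = (a + i) mod L" by (auto simp: cyc_def)
    then have "[w = i] (mod L)" by (simp add: cong_def[symmetric] cong_add_lcancel_nat)
    then show False using i w by (simp add: cong_def)
  qed
  then have 1: "{l} \<times> C \<subseteq> {x \<in> ?W. right_nb L x \<notin> ?W}"
    using lR neg sl by (auto simp: right_nb_def)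
  have "Suc z1 mod L \<notin> ?R"
  proof
    assume "Suc z1 mod L \<in> ?R"
    then obtain i where i: "i < w" "Suc z1 mod L = (a + i) mod L" by (auto simp: cyc_def)
    show False
    proof (cases i)
      case 0
      have "[Suc z1 + (L - 1) = a + (L - 1)] (mod L)"
        using i 0 by (intro cong_add) (auto simp: cong_def)
      then have "z1 = (a + L - 1) mod L" using w z by (simp add: cong_def)
      then show False using neg by simp
    next
      case (Suc j)
      then have "[Suc z1 + (L - 1) = a + Suc j + (L - 1)] (mod L)"
        using i by (intro cong_add) (auto simp: cong_def)
      then have "z1 = (a + j) mod L" using w z by (simp add: cong_def algebra_simps)
      then show False using z(2) Suc i by (auto simp: cyc_def)
    qed
  qed
  moreover have "Suc z1 mod L \<noteq> z1"
    using w z by (metis mod_Suc n_not_Suc_n One_nat_def less_one less_Suc0 mod_less gr_implies_not0 less_antisym not_less_eq)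
  ultimately have 2: "(z1, z2) \<in> {x \<in> ?W. right_nb L x \<notin> ?W}" by (auto simp: right_nb_def)
  have "l \<noteq> z1" using lR z by auto
  have "card (insert (z1, z2) ({l} \<times> C)) \<le> exits (right_nb L) ?W"
    unfolding exits_def by (rule card_mono) (use 1 2 C in auto)
  moreover have "card (insert (z1, z2) ({l} \<times> C)) = Suc (card C)"
    using \<open>l \<noteq> z1\<close> C by (subst card_insert_disjoint) auto
  ultimately show False using ex by simp
qed

text \<open>If \<open>z\<close> stayed within the columns of the rectangle, \<open>W\<close> would
  fit into an n by n+2 box, which \<open>nsm\<close> forbids. So there are \<open>n + 1\<close>
  columns, each with an upward exit; the \<open>n + 1\<close> remaining exits do not suffice for a
  new row.\<close>

lemma protuberance_tall:
  assumes n: "2 \<le> n" and L: "n * (n + 1) + 2 \<le> L" and ab: "a < L" "b < L"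
    and W: "W = insert z (cyc L a n \<times> cyc L b (n + 1))" and z: "z \<in> sites L"
    and hp: "half_per L W \<le> 2 * n + 2" and nsm: "\<not> small_box n W"
  shows "(fst z = (a + n) mod L \<or> fst z = (a + L - 1) mod L) \<and> snd z \<in> cyc L b (n + 1)"
proof -
  let ?R = "cyc L a n" and ?C = "cyc L b (n + 1)"
  have nL: "n + 4 < L" by (rule torus_large[OF n L])
  have cR: "card ?R = n" "card ?C = n + 1" using nL by (simp_all add: card_cyc)
  have ne: "?R \<noteq> {}" "?C \<noteq> {}" using cR n by auto
  have f: "fst ` W = insert (fst z) ?R" "snd ` W = insert (snd z) ?C"
    using W ne by (auto simp: image_insert fst_image_times snd_image_times)
  have cs: "card (snd ` W) \<le> n + 2" using f cR card_insert_le_m1[of "n+2" ?C "snd z"] by simp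
  have zR: "fst z \<notin> ?R"
  proof
    assume "fst z \<in> ?R"
    then have "card (fst ` W) = n" using f cR by (simp add: insert_absorb)
    then show False using nsm cs unfolding small_box_def by simp
  qed
  have cf: "card (fst ` W) = n + 1" using f zR cR by simp
  have Ws: "W \<subseteq> sites L" using W z ab by (auto simp: sites_def cyc_def)
  have r: "card (snd ` W) \<le> exits (right_nb L) W" by (rule exits_right_ge[OF Ws]) (use cf nL in simp)
  have u: "card (fst ` W) \<le> exits (up_nb L) W" by (rule exits_up_ge[OF Ws]) (use cs nL in simp)
  have ex: "exits (right_nb L) W \<le> n + 1" using u hp cf unfolding half_per_def by simp
  then have "card (snd ` W) \<le> n + 1" using r by simp
  then have zC: "snd z \<in> ?C" using f cR by (metis card_insert_disjoint cyc_finite not_less_eq_eq Suc_eq_plus1 le_refl)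
  have "fst z < L" using z by (auto simp: sites_def)
  then show ?thesis using attached_horizontally[of n L ?C "fst z" a "snd z"] n nL zR zC ex cR W by auto
qed

lemma swap_image_times: "prod.swap ` (A \<times> B) = B \<times> A" by auto

text \<open>The wide rectangle is reduced to the tall one by reflection in the diagonal.\<close>

lemma protuberance:
  assumes n: "2 \<le> n" and L: "n * (n + 1) + 2 \<le> L" and ab: "a < L" "b < L"
    and wh: "w = n \<and> ht = n + 1 \<or> w = n + 1 \<and> ht = n"
    and W: "W = insert z (cyc L a w \<times> cyc L b ht)" and z: "z \<in> sites L"
    and hp: "half_per L W \<le> 2 * n + 2" and nsm: "\<not> small_box n W"
  shows "z \<in> long_side_nbrs L a b w ht"
  using wh
proof
  assume wh: "w = n \<and> ht = n + 1"
  then have "(fst z = (a + n) mod L \<or> fst z = (a + L - 1) mod L) \<and> snd z \<in> cyc L b (n + 1)"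
    using protuberance_tall[OF n L ab _ z hp nsm] W by blast
  then show ?thesis using wh by (cases z) (auto simp: long_side_nbrs_def cyc_def)
next
  assume wh: "w = n + 1 \<and> ht = n"
  let ?W = "prod.swap ` W" and ?z = "prod.swap z"
  have "?W = insert ?z (cyc L b n \<times> cyc L a (n + 1))" using W wh by (simp add: swap_image_times)
  moreover have "half_per L ?W \<le> 2 * n + 2" using hp by (simp add: half_per_def exits_swap exits_swap')
  moreover have "\<not> small_box n ?W" using nsm by (auto simp: small_box_def image_image)
  moreover have "?z \<in> sites L" using z by (auto simp: sites_def)
  ultimately have "(fst ?z = (b + n) mod L \<or> fst ?z = (b + L - 1) mod L) \<and> snd ?z \<in> cyc L a (n + 1)"
    using protuberance_tall[OF n L ab(2,1)] by blast
  then show ?thesis using wh by (cases z) (auto simp: long_side_nbrs_def cyc_def)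
qed

subsection \<open>Covering by balls\<close>

definition nbrs :: "nat \<Rightarrow> site \<Rightarrow> site set" where
  "nbrs L x = {right_nb L x, up_nb L x, ((fst x + L - 1) mod L, snd x), (fst x, (snd x + L - 1) mod L)}"

primrec nball :: "nat \<Rightarrow> nat \<Rightarrow> site \<Rightarrow> site set" where
  "nball L 0 x = {x}"
| "nball L (Suc r) x = nball L r x \<union> (\<Union>y\<in>nball L r x. nbrs L y)"

lemma finite_nbrs: "finite (nbrs L x)" by (simp add: nbrs_def)

lemma card_nbrs: "card (nbrs L x) \<le> 4"
proof -
  have "nbrs L x = set [right_nb L x, up_nb L x, ((fst x + L - 1) mod L, snd x), (fst x, (snd x + L - 1) mod L)]"
    by (simp add: nbrs_def)
  then show ?thesis using card_length[of "[right_nb L x, up_nb L x, ((fst x + L - 1) mod L, snd x), (fst x, (snd x + L - 1) mod L)]"]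
    by (simp del: set_simps)
qed

lemma finite_nball: "finite (nball L r x)"
  by (induction r) (auto simp: finite_nbrs)

lemma card_nball: "card (nball L r x) \<le> 5 ^ r"
proof (induction r)
  case (Suc r)
  have "card (nball L (Suc r) x) \<le> card (nball L r x) + card (\<Union>y\<in>nball L r x. nbrs L y)"
    by (simp add: card_Un_le)
  also have "card (\<Union>y\<in>nball L r x. nbrs L y) \<le> (\<Sum>y\<in>nball L r x. card (nbrs L y))"
    by (rule card_UN_le[OF finite_nball])
  also have "\<dots> \<le> (\<Sum>y\<in>nball L r x. 4)" by (rule sum_mono[OF card_nbrs])
  finally show ?case using Suc by simp
qed simp

lemma nball_mono: "r \<le> r' \<Longrightarrow> nball L r x \<subseteq> nball L r' x"
  by (induction rule: dec_induct) auto

lemma pred_mod: "a < L \<Longrightarrow> (Suc a mod L + L - 1) mod L = a"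
  by (cases "Suc a = L") simp_all

lemma nbrs_right: "x \<in> sites L \<Longrightarrow> x \<in> nbrs L (right_nb L x)"
  using pred_mod[of "fst x" L] by (cases x) (simp add: nbrs_def right_nb_def sites_def)

lemma nbrs_up: "x \<in> sites L \<Longrightarrow> x \<in> nbrs L (up_nb L x)"
  using pred_mod[of "snd x" L] by (cases x) (simp add: nbrs_def up_nb_def sites_def)

text \<open>No edge joins \<open>C\<close> to the rest in either direction, so an exit of
  \<open>V\<close> is an exit of exactly one of the two parts, and conversely.\<close>

lemma exits_split:
  assumes "finite V" "C \<subseteq> V" "\<And>y. y \<in> C \<Longrightarrow> f y \<in> V \<Longrightarrow> f y \<in> C"
    "\<And>y. y \<in> V \<Longrightarrow> f y \<in> C \<Longrightarrow> y \<in> C"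
  shows "exits f V = exits f C + exits f (V - C)"
proof -
  let ?A = "{x \<in> C. f x \<notin> C}" and ?B = "{x \<in> V - C. f x \<notin> V - C}"
  have eq: "{x \<in> V. f x \<notin> V} = ?A \<union> ?B"
    using assms(2-4) by blast
  have "finite C" using assms(1,2) finite_subset by blast
  then have "finite ?A" "finite ?B" using assms(1) by simp_all
  moreover have "?A \<inter> ?B = {}" by blast
  ultimately show ?thesis
    unfolding exits_def eq by (rule card_Un_disjoint)
qed

text \<open>\<open>C\<close> is the connected component of \<open>x\<close> in
  \<open>V\<close>.\<close>

lemma component:
  assumes V: "V \<subseteq> sites L" and x: "x \<in> V" and m: "card V \<le> m"
  obtains C where "C \<subseteq> V" "x \<in> C" "C \<subseteq> nball L (m * m) x"
    "half_per L V = half_per L C + half_per L (V - C)"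
proof -
  have fin: "finite V" using V finite_subset finite_sites by blast
  define R where "R = {(u, v). u \<in> V \<and> v \<in> V \<and> v \<in> nbrs L u}"
  define C where "C = {y. (x, y) \<in> R\<^sup>*}"
  have RV: "R \<subseteq> V \<times> V" by (auto simp: R_def)
  have CV: "C \<subseteq> V"
  proof
    fix y assume "y \<in> C"
    then have "(x, y) \<in> R\<^sup>*" by (simp add: C_def)
    then show "y \<in> V" by (induction) (use x RV in auto)
  qed
  have closed: "v \<in> C" if "u \<in> C" "(u, v) \<in> R" for u v
    using that unfolding C_def by auto
  have relpow_ball: "y \<in> nball L k x" if "(x, y) \<in> R ^^ k" for k y
    using that by (induction k arbitrary: y) (auto simp: R_def)
  have finR: "finite R" using RV fin finite_subset by blast
  \<comment> \<open>A reachable site is reached in at most \<open>card R\<close> steps, and there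
    are at most \<open>m * m\<close> adjacent pairs; this is the origin of the radius.\<close>
  have "card R \<le> card V * card V"
    using card_mono[OF _ RV] fin by (simp add: card_cartesian_product)
  also have "\<dots> \<le> m * m" using m by (simp add: mult_le_mono)
  finally have cR: "card R \<le> m * m" .
  have "C \<subseteq> nball L (m * m) x"
  proof
    fix y assume "y \<in> C"
    then have "(x, y) \<in> (\<Union>k\<in>{k. k \<le> card R}. R ^^ k)"
      using rtrancl_finite_eq_relpow[OF finR] by (simp add: C_def)
    then obtain k where "k \<le> card R" "(x, y) \<in> R ^^ k" by blast
    then show "y \<in> nball L (m * m) x"
      using relpow_ball nball_mono[of k "m * m" L x] cR by (meson le_trans subsetD)
  qed
  moreover have "x \<in> C" by (simp add: C_def)
  moreover have "exits (right_nb L) V = exits (right_nb L) C + exits (right_nb L) (V - C)"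
  proof (rule exits_split[OF fin CV])
    fix y assume "y \<in> C" "right_nb L y \<in> V"
    then show "right_nb L y \<in> C" using closed[of y "right_nb L y"] CV by (simp add: R_def nbrs_def subsetD)
  next
    fix y assume "y \<in> V" "right_nb L y \<in> C"
    then have "(right_nb L y, y) \<in> R" unfolding R_def using nbrs_right[of y L] CV V by blast
    then show "y \<in> C" using closed \<open>right_nb L y \<in> C\<close> by blast
  qed
  moreover have "exits (up_nb L) V = exits (up_nb L) C + exits (up_nb L) (V - C)"
  proof (rule exits_split[OF fin CV])
    fix y assume "y \<in> C" "up_nb L y \<in> V"
    then show "up_nb L y \<in> C" using closed[of y "up_nb L y"] CV by (simp add: R_def nbrs_def subsetD)
  next
    fix y assume "y \<in> V" "up_nb L y \<in> C"
    then have "(up_nb L y, y) \<in> R" unfolding R_def using nbrs_up[of y L] CV V by blast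
    then show "y \<in> C" using closed \<open>up_nb L y \<in> C\<close> by blast
  qed
  ultimately show ?thesis
    by (intro that[OF CV]) (simp_all add: half_per_def)
qed

lemma half_per_ge_2:
  assumes "V \<subseteq> sites L" "V \<noteq> {}" "card (fst ` V) < L" "card (snd ` V) < L"
  shows "2 \<le> half_per L V"
proof -
  have "finite V" using assms(1) finite_subset finite_sites by blast
  then have "0 < card (fst ` V)" "0 < card (snd ` V)" using assms(2) by (auto simp: card_gt_0_iff)
  then show ?thesis using half_per_ge[OF assms(1,3,4)] by linarith
qed

text \<open>The isoperimetric inequality for \<open>k\<close> components with \<open>v\<close> sites
  and half perimeter \<open>e\<close> in total. The worst case has \<open>k - 1\<close> isolated
  sites, each of half perimeter 2, and one set that holds the remaining \<open>v - k + 1\<close>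
  sites with half perimeter \<open>e - 2 * k + 2\<close>. Integers avoid truncated
  subtraction.\<close>

definition cover_bound :: "nat \<Rightarrow> nat \<Rightarrow> nat \<Rightarrow> bool" where
  "cover_bound k v e \<longleftrightarrow> 1 \<le> k \<and> k \<le> v \<and> 2 * k \<le> e \<and> 4 * (int v - int k + 1) \<le> (int e - 2 * int k + 2)\<^sup>2"

text \<open>Components with semiperimeters \<open>s\<close> and \<open>t\<close> have together no more sites than a single set of
  semiperimeter \<open>s + t - 2\<close> together with an isolated site.\<close>
lemma cover_bound_step:
  assumes "cover_bound k v e" "4 * v' \<le> e'\<^sup>2" "2 \<le> e'" "1 \<le> v'"
  shows "cover_bound (Suc k) (v' + v) (e' + e)"
proof -
  define s t where "s = int e'" and "t = int e - 2 * int k + 2"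
  have st: "2 \<le> s" "2 \<le> t" using assms unfolding cover_bound_def s_def t_def by linarith+
  have "4 * int v' \<le> s\<^sup>2" using of_nat_mono[OF assms(2), where 'a=int] by (simp add: s_def)
  moreover have "4 * (int v - int k + 1) \<le> t\<^sup>2" using assms by (simp add: cover_bound_def t_def)
  moreover have "0 \<le> (s - 2) * (t - 2)" using st by simp
  moreover have "(s + t - 2)\<^sup>2 = s\<^sup>2 + t\<^sup>2 - 4 + 2 * ((s - 2) * (t - 2))"
    by (simp add: power2_eq_square algebra_simps)
  moreover have "4 * (a + b - c) \<le> Q" if "4 * a \<le> S" "4 * (b - c + 1) \<le> T" "0 \<le> P" "Q = S + T - 4 + 2 * P"
    for a b c S T P Q :: int using that by arith
  ultimately have "4 * (int v' + int v - int k) \<le> (s + t - 2)\<^sup>2" by blast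
  then show ?thesis using assms unfolding cover_bound_def s_def t_def by (simp add: algebra_simps)
qed

text \<open>Components are split off one at a time; each gives one ball, centred at one of its own
  sites, and the half perimeters add up.\<close>

lemma cover_by_balls:
  assumes "V \<subseteq> sites L" "V \<noteq> {}" "card (fst ` V) < L" "card (snd ` V) < L" "card V \<le> m"
  shows "\<exists>xs. set xs \<subseteq> sites L \<and> V \<subseteq> (\<Union>x\<in>set xs. nball L (m * m) x)
            \<and> cover_bound (length xs) (card V) (half_per L V)"
proof -
  have "finite V" using assms(1) finite_subset finite_sites by blast
  then show ?thesis using assms
  proof (induction rule: finite_psubset_induct)
    case (psubset V)
    note prems = psubset.prems
    obtain x where x: "x \<in> V" using prems by blast
    obtain C where C: "C \<subseteq> V" "x \<in> C" "C \<subseteq> nball L (m * m) x"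
      "half_per L V = half_per L C + half_per L (V - C)"
      by (rule component[OF prems(1) x prems(5)])
    have proj: "card (f ` U) < L" if "U \<subseteq> V" "card (f ` V) < L" for f :: "site \<Rightarrow> nat" and U
      using card_mono[OF finite_imageI[OF psubset.hyps(1)] image_mono[OF that(1)], of f] that(2) by simp
    have Cs: "C \<subseteq> sites L" "C \<noteq> {}" "card (fst ` C) < L" "card (snd ` C) < L"
      using C prems proj by auto
    have finC: "finite C" using C psubset.hyps finite_subset by blast
    have C1: "4 * card C \<le> (half_per L C)\<^sup>2" "2 \<le> half_per L C" "1 \<le> card C"
      using card_le_half_per_sq[OF Cs(1,3,4)] half_per_ge_2[OF Cs] Cs(2) finC card_gt_0_iff[of C] by linarith+
    show ?case
    proof (cases "C = V")
      case True
      \<comment> \<open>For one component the bound is the isoperimetric inequality itself.\<close>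
      have "cover_bound 1 (card C) (half_per L C)"
        using C1 of_nat_mono[OF C1(1), where 'a=int] by (simp add: cover_bound_def)
      then show ?thesis
        using True C(3) subsetD[OF prems(1) x] by (intro exI[of _ "[x]"]) simp
    next
      case False
      have "V - C \<subset> V" "V - C \<noteq> {}" using C False by auto
      moreover have "card (V - C) \<le> m"
        using prems(5) card_mono[OF psubset.hyps(1) Diff_subset[of V C]] by simp
      ultimately obtain xs where xs: "set xs \<subseteq> sites L" "V - C \<subseteq> (\<Union>x\<in>set xs. nball L (m * m) x)"
        "cover_bound (length xs) (card (V - C)) (half_per L (V - C))"
        using psubset.IH[of "V - C"] prems(1) proj[OF Diff_subset prems(3)] proj[OF Diff_subset prems(4)]
        by blast
      have "cover_bound (length (x # xs)) (card V) (half_per L V)"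
        using cover_bound_step[OF xs(3) C1] C(1,4) psubset.hyps(1) finC
        by (simp add: card_Diff_subset card_mono)
      then show ?thesis
        using xs C x prems(1) by (intro exI[of _ "x # xs"]) auto
    qed
  qed
qed

text \<open>If it failed, then \<open>K <= 2 * N\<close>, since every component has half perimeter
  at least 2, and the quadratic bound would give \<open>4 * N * (K - 1) + 4 <= K * K\<close>, which
  is impossible in that range. The conclusion charges one unit of half perimeter, that is energy 2,
  for every ball after the first.\<close>

lemma cover_bound_critical:
  assumes n: "2 \<le> n" and c: "cover_bound k v e" and v: "n * (n + 1) + 1 \<le> v"
  shows "2 * n + 1 + k \<le> e"
proof (rule ccontr)
  assume "\<not> ?thesis"
  then have e: "e \<le> 2 * n + k" by simp
  define N K where "N = int n" and "K = int k"
  have K: "1 \<le> K" "K \<le> 2 * N" and N: "2 \<le> N"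
    using c e n unfolding cover_bound_def N_def K_def by linarith+
  have "int e - 2 * K + 2 \<le> 2 * N - K + 2" "0 \<le> int e - 2 * K + 2"
    using c e unfolding cover_bound_def N_def K_def by linarith+
  then have "(int e - 2 * K + 2)\<^sup>2 \<le> (2 * N - K + 2)\<^sup>2" by (rule power_mono)
  moreover have "4 * (int v - K + 1) \<le> (int e - 2 * K + 2)\<^sup>2"
    using c by (simp add: cover_bound_def K_def)
  moreover have "N * (N + 1) + 1 \<le> int v"
    using of_nat_mono[OF v, where 'a=int] by (simp add: N_def algebra_simps)
  moreover have "4 * (M + 1 - K + 1) \<le> Y" if "X \<le> Y" "4 * (w - K + 1) \<le> X" "M + 1 \<le> w"
    for X Y M w :: int using that by arith
  ultimately have "4 * (N * (N + 1) + 1 - K + 1) \<le> (2 * N - K + 2)\<^sup>2" by blast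
  then have *: "4 * N * (K - 1) + 4 \<le> K * K" by (simp add: power2_eq_square algebra_simps)
  show False
  proof (cases "K = 1")
    case False
    then have "2 \<le> K" using K by simp
    have "2 * K * (K - 1) \<le> 4 * N * (K - 1)" using K by (intro mult_right_mono) auto
    moreover have "2 * K \<le> K * K" using \<open>2 \<le> K\<close> by (intro mult_right_mono) auto
    moreover have "2 * K * (K - 1) = 2 * (K * K) - 2 * K" by (simp add: algebra_simps)
    ultimately show False using * by linarith
  qed (use * in simp)
qed

text \<open>One unit better than in the critical case. For \<open>k = 1\<close> this is the
  hypothesis \<open>e0\<close>; for more balls the extra unit again comes from the quadratic
  bound.\<close>

lemma cover_bound_supercritical:
  assumes n: "2 \<le> n" and c: "cover_bound k v e" and v: "n * (n + 1) + 2 \<le> v"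
    and e0: "2 * n + 3 \<le> e"
  shows "2 * n + 2 + k \<le> e"
proof (rule ccontr)
  assume "\<not> ?thesis"
  then have e: "e \<le> 2 * n + k + 1" by simp
  define N K where "N = int n" and "K = int k"
  have K: "2 \<le> K" "K \<le> 2 * N + 1" and N: "2 \<le> N"
    using c e e0 n unfolding cover_bound_def N_def K_def by linarith+
  have "int e - 2 * K + 2 \<le> 2 * N - K + 3" "0 \<le> int e - 2 * K + 2"
    using c e unfolding cover_bound_def N_def K_def by linarith+
  then have "(int e - 2 * K + 2)\<^sup>2 \<le> (2 * N - K + 3)\<^sup>2" by (rule power_mono)
  moreover have "4 * (int v - K + 1) \<le> (int e - 2 * K + 2)\<^sup>2"
    using c by (simp add: cover_bound_def K_def)
  moreover have "N * (N + 1) + 2 \<le> int v"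
    using of_nat_mono[OF v, where 'a=int] by (simp add: N_def algebra_simps)
  moreover have "4 * (M + 2 - K + 1) \<le> Y" if "X \<le> Y" "4 * (w - K + 1) \<le> X" "M + 2 \<le> w"
    for X Y M w :: int using that by arith
  ultimately have "4 * (N * (N + 1) + 2 - K + 1) \<le> (2 * N - K + 3)\<^sup>2" by blast
  then have *: "4 * N * (K - 2) + 3 + 2 * K \<le> K * K" by (simp add: power2_eq_square algebra_simps)
  have "2 * (K - 1) * (K - 2) \<le> 4 * N * (K - 2)" using K by (intro mult_right_mono) auto
  then have "2 * (K * K) - 6 * K + 4 \<le> 4 * N * (K - 2)" by (simp add: algebra_simps)
  moreover have "0 \<le> K * K - 4 * K + 4"
    using zero_le_square[of "K - 2"] by (simp add: algebra_simps)
  moreover have False if "A + 3 + 2 * K \<le> Q" "2 * Q - 6 * K + 4 \<le> A" "0 \<le> Q - 4 * K + 4" for A Q :: int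
    using that by arith
  ultimately show False using * by blast
qed

subsection \<open>Energy of the boundary of the subcritical set\<close>

text \<open>The energy relative to the background when the spins on \<open>V\<close> have the next
  value; the perimeter is twice \<open>half_per\<close>.\<close>

definition surf_energy :: "nat \<Rightarrow> real \<Rightarrow> site set \<Rightarrow> real" where
  "surf_energy L h V = 2 * real (half_per L V) - h * real (card V)"

text \<open>The relative energy of an n by n+1 rectangle with one attached site: half perimeter 2n+2
  and n(n+1)+1 sites.\<close>

definition crit_energy :: "nat \<Rightarrow> real \<Rightarrow> real" where
  "crit_energy n h = 4 * real n + 4 - h * (real n * (real n + 1) + 1)"

text \<open>With a shorter side at most n-1 the box has at most (n-1)(n+2) sites, fewer than n(n+1);
  a longer side of at most n+1 does not exceed n(n+1) either.\<close>

lemma full_small_box: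
  fixes p q n :: nat
  assumes "p \<le> n" "q \<le> n + 2" "n * (n + 1) < p * q" "2 \<le> n"
  shows "p = n \<and> q = n + 2"
proof -
  have "p = n"
  proof (rule ccontr)
    assume "p \<noteq> n"
    then obtain m where m: "n = Suc m" "p \<le> m" using assms by (cases n) auto
    have "p * q \<le> m * (n + 2)" using m assms by (intro mult_le_mono) auto
    also have "\<dots> \<le> n * (n + 1)" using m by simp
    finally show False using assms by simp
  qed
  moreover from this have "n + 1 < q" using assms(3) by (metis mult_less_cancel1)
  ultimately show ?thesis using assms by simp
qed

lemma card_insert_le_Suc: "card (insert x A) \<le> Suc (card A)"
  by (cases "finite A") (simp_all add: card_insert_if)

text \<open>There are two ways out. Either the volume was exactly at its threshold, or it was above
  it; then \<open>V\<close> spans an n by n+2 box, and the new site sticks out of this box and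
  enlarges a projection.\<close>

lemma boundary_cases:
  assumes n: "2 \<le> n" and L: "n * (n + 1) + 2 \<le> L"
    and V: "V \<subseteq> sites L" and sub: "subcritical n V" and nsub: "\<not> subcritical n (insert z V)"
  shows "card (fst ` insert z V) < L \<and> card (snd ` insert z V) < L \<and>
    (card V = n * (n + 1) \<and> card (insert z V) = n * (n + 1) + 1 \<or>
     n * (n + 1) + 2 \<le> card (insert z V) \<and> card (insert z V) \<le> n * (n + 2) + 1 \<and>
     2 * n + 3 \<le> card (fst ` insert z V) + card (snd ` insert z V))"
proof -
  let ?W = "insert z V"
  have fin: "finite V" using V finite_subset finite_sites by blast
  have zV: "z \<notin> V" using sub nsub by (metis insert_absorb)
  then have cW: "card ?W = Suc (card V)" using fin by simp
  have big: "n * (n + 1) < card ?W" "\<not> small_box n ?W" using nsub unfolding subcritical_def by simp_all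
  show ?thesis
  proof (cases "card V \<le> n * (n + 1)")
    case True
    then have "card V = n * (n + 1)" using big cW by simp
    moreover have "card (f ` ?W) \<le> card ?W" for f :: "site \<Rightarrow> nat"
      by (rule card_image_le) (use fin in simp)
    ultimately show ?thesis using cW L by (metis Suc_eq_plus1 add_2_eq_Suc' le_less_trans less_eq_Suc_le)
  next
    case False
    let ?p = "card (fst ` V)" and ?q = "card (snd ` V)"
    have ins: "card (f ` ?W) \<le> Suc (card (f ` V))" "card (f ` V) \<le> card (f ` ?W)" for f :: "site \<Rightarrow> nat"
      using fin card_insert_le_Suc[of "f z" "f ` V"] by (auto intro: card_mono)
    have cpq: "card V \<le> ?p * ?q" by (rule card_le_proj[OF fin])
    have "small_box n V" using sub False unfolding subcritical_def by simp
    then have "?p = n \<and> ?q = n + 2 \<or> ?q = n \<and> ?p = n + 2"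
    proof (unfold small_box_def, elim disjE conjE)
      assume "?p \<le> n" "?q \<le> n + 2" then show ?thesis using full_small_box[of ?p n ?q] False cpq n by linarith
    next
      assume "?p \<le> n + 2" "?q \<le> n" then show ?thesis
        using full_small_box[of ?q n ?p] False cpq n by (simp add: mult.commute)
    qed
    moreover from this have "card V \<le> n * (n + 2)" using cpq by (metis mult.commute)
    ultimately show ?thesis
      using ins[of fst] ins[of snd] big(2) False cW torus_large[OF n L]
      unfolding small_box_def by auto
  qed
qed

lemma boundary_size:
  assumes n: "2 \<le> n" and L: "n * (n + 1) + 2 \<le> L"
    and V: "V \<subseteq> sites L" and sub: "subcritical n V" and nsub: "\<not> subcritical n (insert z V)"
  shows "card (fst ` insert z V) < L" "card (snd ` insert z V) < L" "card (insert z V) \<le> (n + 1)\<^sup>2"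
  using boundary_cases[OF assms] by (auto simp: power2_eq_square)

text \<open>Every ball after the first is paid for at the outer set. For a single ball the margin is
  found at the outer set or at the inner one, unless the step attaches a site to a long side of a
  rectangle.\<close>

lemma boundary_energy:
  assumes h: "0 < h" "h * real n < 2" and n: "2 \<le> n" and L: "n * (n + 1) + 2 \<le> L"
    and V: "V \<subseteq> sites L" and z: "z \<in> sites L"
    and sub: "subcritical n V" and nsub: "\<not> subcritical n (insert z V)"
  obtains xs where "set xs \<subseteq> sites L" "insert z V \<subseteq> (\<Union>x\<in>set xs. nball L ((n + 1)\<^sup>2 * (n + 1)\<^sup>2) x)"
    "1 \<le> length xs" "length xs \<le> (n + 1)\<^sup>2"
    "crit_energy n h + 2 * (real (length xs) - 1) \<le> surf_energy L h (insert z V)"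
    "length xs = 1 \<longrightarrow> crit_energy n h + (2 - h * real n) \<le> surf_energy L h (insert z V)
       \<or> crit_energy n h + h \<le> surf_energy L h V
       \<or> (\<exists>a b w ht. a < L \<and> b < L \<and> (w = n \<and> ht = n + 1 \<or> w = n + 1 \<and> ht = n)
            \<and> V = cyc L a w \<times> cyc L b ht \<and> z \<in> long_side_nbrs L a b w ht)"
proof -
  let ?W = "insert z V"
  let ?e = "half_per L ?W"
  note size = boundary_size[OF n L V sub nsub]
  have Ws: "?W \<subseteq> sites L" "?W \<noteq> {}" using V z by auto
  obtain xs where xs: "set xs \<subseteq> sites L" "?W \<subseteq> (\<Union>x\<in>set xs. nball L ((n + 1)\<^sup>2 * (n + 1)\<^sup>2) x)"
    "cover_bound (length xs) (card ?W) ?e"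
    using cover_by_balls[OF Ws size] by blast
  let ?k = "length xs"
  have k: "1 \<le> ?k" "?k \<le> (n + 1)\<^sup>2" using xs(3) size(3) unfolding cover_bound_def by linarith+
  consider (A) "card V = n * (n + 1)" "card ?W = n * (n + 1) + 1"
    | (B) "n * (n + 1) + 2 \<le> card ?W" "card ?W \<le> n * (n + 2) + 1"
      "2 * n + 3 \<le> card (fst ` ?W) + card (snd ` ?W)"
    using boundary_cases[OF n L V sub nsub] by blast
  then show ?thesis
  proof cases
    case A
    have e: "2 * n + 1 + ?k \<le> ?e"
      using cover_bound_critical[OF n xs(3)] A by simp
    have W: "surf_energy L h ?W = crit_energy n h + 2 * (real ?e - (2 * real n + 2))"
      using A(2) by (simp add: surf_energy_def crit_energy_def algebra_simps)
    \<comment> \<open>The inner set has one site less than the droplet, so that at the same half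
      perimeter its energy is higher by \<open>h\<close>.\<close>
    have Vv: "surf_energy L h V = crit_energy n h + h + 2 * (real (half_per L V) - (2 * real n + 2))"
      using A(1) by (simp add: surf_energy_def crit_energy_def algebra_simps)
    have "real (2 * n + 1 + ?k) \<le> real ?e" using e by (rule of_nat_mono)
    then have 1: "crit_energy n h + 2 * (real ?k - 1) \<le> surf_energy L h ?W" unfolding W by simp
    have 2: "crit_energy n h + (2 - h * real n) \<le> surf_energy L h ?W
       \<or> crit_energy n h + h \<le> surf_energy L h V
       \<or> (\<exists>a b w ht. a < L \<and> b < L \<and> (w = n \<and> ht = n + 1 \<or> w = n + 1 \<and> ht = n)
            \<and> V = cyc L a w \<times> cyc L b ht \<and> z \<in> long_side_nbrs L a b w ht)"
    proof (cases "2 * n + 3 \<le> ?e")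
      case True
      then have "real (2 * n + 3) \<le> real ?e" by (rule of_nat_mono)
      moreover have "0 \<le> h * real n" using h by simp
      ultimately show ?thesis unfolding W by (intro disjI1) simp
    next
      case hpW: False
      show ?thesis
      proof (cases "2 * n + 2 \<le> half_per L V")
        case True
        then have "real (2 * n + 2) \<le> real (half_per L V)" by (rule of_nat_mono)
        then show ?thesis unfolding Vv by (intro disjI2 disjI1) simp
      next
        case False
        have "n * (n + 1) < L" "half_per L V \<le> 2 * n + 1" using L False by simp_all
        then obtain a b w ht where r: "a < L" "b < L" "w = n \<and> ht = n + 1 \<or> w = n + 1 \<and> ht = n"
          "V = cyc L a w \<times> cyc L b ht"
          using rect_of_small_half_per[OF V n _ A(1)] by blast
        have "z \<in> long_side_nbrs L a b w ht"
          by (rule protuberance[OF n L r(1-3) _ z]) (use r(4) hpW nsub in \<open>auto simp: subcritical_def\<close>)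
        then show ?thesis using r by blast
      qed
    qed
    show ?thesis using 2 by (intro that[OF xs(1,2) k 1]) blast
  next
    case B
    have "2 * n + 3 \<le> ?e" using half_per_ge[OF Ws(1) size(1,2)] B(3) by linarith
    then have e: "2 * n + 2 + ?k \<le> ?e"
      using cover_bound_supercritical[OF n xs(3) B(1)] by simp
    have "real (2 * n + 2 + ?k) \<le> real ?e" using e by (rule of_nat_mono)
    \<comment> \<open>There are at most \<open>n\<close> sites more than in the droplet. They gain
      at most \<open>h * n < 2\<close>, less than the cost of the additional unit of half
      perimeter.\<close>
    moreover have "h * real (card ?W) \<le> h * (real n * (real n + 2) + 1)"
      using of_nat_mono[OF B(2), where 'a=real] h by (intro mult_left_mono) (auto simp: algebra_simps)
    ultimately have F: "crit_energy n h + 2 * (real ?k - 1) + (2 - h * real n) \<le> surf_energy L h ?W"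
      by (simp add: surf_energy_def crit_energy_def algebra_simps)
    moreover have "0 \<le> 2 * (real ?k - 1)" using k by simp
    ultimately show ?thesis using h by (intro that[OF xs(1,2) k]) auto
  qed
qed

subsection \<open>Configurations and the Hamiltonian\<close>

text \<open>Both other spin values are counted, so that the cut-off depends on a shape alone; by
  \<open>Ham_ge\<close> the value other than \<open>bg + 1\<close> only adds energy.\<close>

definition spin_set :: "nat \<Rightarrow> int \<Rightarrow> config \<Rightarrow> site set" where
  "spin_set L bg \<sigma> = {x \<in> sites L. \<sigma> x \<noteq> bg}"

definition cfg :: "nat \<Rightarrow> int \<Rightarrow> site set \<Rightarrow> config" where
  "cfg L bg V = (\<lambda>x. if x \<in> sites L then (if x \<in> V then bg + 1 else bg) else 0)"

lemma spin_set_sites: "spin_set L bg \<sigma> \<subseteq> sites L"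
  by (auto simp: spin_set_def)

lemma finite_spin_set: "finite (spin_set L bg \<sigma>)"
  by (rule finite_subset[OF spin_set_sites finite_sites])

lemma spin_set_cfg: "V \<subseteq> sites L \<Longrightarrow> spin_set L bg (cfg L bg V) = V"
  by (auto simp: spin_set_def cfg_def)

lemma cfg_configs: "bg \<in> {-1, 0} \<Longrightarrow> cfg L bg V \<in> configs L"
  unfolding configs_def cfg_def by auto

lemma cfg_empty: "cfg L bg {} = const_cfg L bg"
  by (rule ext) (simp add: cfg_def const_cfg_def)

lemma flip_cfg:
  assumes "bg \<in> {-1, 0}" "z \<in> sites L" "z \<notin> V"
  shows "flip True z (cfg L bg V) = cfg L bg (insert z V)"
proof
  fix y show "flip True z (cfg L bg V) y = cfg L bg (insert z V) y"
    using assms by (cases "y = z") (auto simp: flip_def cfg_def succ3_def)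
qed

lemma spin_values:
  assumes "\<sigma> \<in> configs L" "x \<in> sites L"
  shows "\<sigma> x \<in> {-1, 0, 1}"
  using assms by (simp add: configs_def)

lemma flip_configs:
  assumes "\<sigma> \<in> configs L" "x \<in> sites L"
  shows "flip s x \<sigma> \<in> configs L"
proof -
  define v where "v = (if s then succ3 (\<sigma> x) else pred3 (\<sigma> x))"
  have v: "v \<in> {-1, 0, 1}"
    using spin_values[OF assms] unfolding v_def by (auto simp: succ3_def pred3_def)
  have "(\<sigma>(x := v)) y \<in> {-1, 0, 1}" if "y \<in> sites L" for y
    using v spin_values[OF assms(1) that] by (cases "y = x") simp_all
  moreover have "(\<sigma>(x := v)) y = 0" if "y \<notin> sites L" for y
  proof -
    have "y \<noteq> x" using assms(2) that by blast
    moreover have "\<sigma> y = 0" using assms(1) that unfolding configs_def by blast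
    ultimately show ?thesis by simp
  qed
  ultimately show ?thesis unfolding configs_def flip_def v_def by blast
qed

lemma flip_flip:
  assumes "\<sigma> \<in> configs L" "x \<in> sites L"
  shows "flip (\<not> s) x (flip s x \<sigma>) = \<sigma>"
proof
  fix y show "flip (\<not> s) x (flip s x \<sigma>) y = \<sigma> y"
    using spin_values[OF assms] by (cases "y = x"; cases s) (auto simp: flip_def succ3_def pred3_def)
qed

lemma spin_set_flip: "spin_set L bg (flip s x \<sigma>) \<subseteq> insert x (spin_set L bg \<sigma>)"
proof
  fix y assume "y \<in> spin_set L bg (flip s x \<sigma>)"
  then show "y \<in> insert x (spin_set L bg \<sigma>)"
    by (cases "y = x") (simp_all add: spin_set_def flip_def)
qed

lemma finite_configs: "finite (configs L)"
proof -
  have "configs L = {f. \<forall>x. (x \<in> sites L \<longrightarrow> f x \<in> {-1, 0, 1}) \<and> (x \<notin> sites L \<longrightarrow> f x = 0)}"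
    by (auto simp: configs_def)
  then show ?thesis
    by (simp only:) (rule finite_set_of_finite_funs, simp_all)
qed

lemma surf_energy_empty [simp]: "surf_energy L h {} = 0"
  by (simp add: surf_energy_def half_per_def exits_def)

lemma surf_energy_sum:
  assumes "V \<subseteq> sites L"
  shows "surf_energy L h V =
    (\<Sum>x\<in>sites L. (indicator V (right_nb L x) - indicator V x)\<^sup>2 + (indicator V (up_nb L x) - indicator V x)\<^sup>2)
      - h * (\<Sum>x\<in>sites L. indicator V x)"
  using sum_indicator_diff_exits[OF finite_sites inj_right_nb image_subsetI[OF right_nb_sites] assms]
    sum_indicator_diff_exits[OF finite_sites inj_up_nb image_subsetI[OF up_nb_sites] assms]
    sum_indicator_subset[OF finite_sites assms]
  by (simp add: surf_energy_def half_per_def sum.distrib)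

lemma Ham_const: "Ham L h (const_cfg L c) = - h * (\<Sum>x\<in>sites L. real_of_int c)"
  by (simp add: Ham_def const_cfg_def right_nb_sites up_nb_sites)

lemma Ham_cfg:
  assumes "V \<subseteq> sites L"
  shows "Ham L h (cfg L bg V) - Ham L h (const_cfg L bg) = surf_energy L h V"
proof -
  have v: "real_of_int (cfg L bg V x) = real_of_int bg + indicator V x" if "x \<in> sites L" for x
    using that by (simp add: cfg_def indicator_def)
  have "(\<Sum>x\<in>sites L. real_of_int (cfg L bg V x)) = (\<Sum>x\<in>sites L. real_of_int bg + indicator V x)"
    by (rule sum.cong[OF refl v])
  also have "\<dots> = (\<Sum>x\<in>sites L. real_of_int bg) + (\<Sum>x\<in>sites L. indicator V x)"
    by (rule sum.distrib)
  finally have "(\<Sum>x\<in>sites L. real_of_int (cfg L bg V x)) = (\<Sum>x\<in>sites L. real_of_int bg) + (\<Sum>x\<in>sites L. indicator V x)" .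
  moreover have "(\<Sum>x\<in>sites L. real_of_int ((cfg L bg V (right_nb L x) - cfg L bg V x)\<^sup>2)
                   + real_of_int ((cfg L bg V (up_nb L x) - cfg L bg V x)\<^sup>2)) =
     (\<Sum>x\<in>sites L. (indicator V (right_nb L x) - indicator V x)\<^sup>2 + (indicator V (up_nb L x) - indicator V x)\<^sup>2)"
    by (rule sum.cong) (simp_all only: of_int_power of_int_diff v right_nb_sites up_nb_sites add_diff_cancel_left)
  ultimately show ?thesis
    unfolding surf_energy_sum[OF assms] Ham_const by (simp add: Ham_def algebra_simps)
qed

text \<open>For \<open>s\<close> the root of the volume, isoperimetry bounds the energy below by
  \<open>4 * s - h * s\<^sup>2 = s * (4 - h * s)\<close>. Here \<open>1 <= s <= n + 1\<close>, and
  \<open>h * (n + 1) <= 3\<close> since \<open>h * n < 2\<close> and \<open>h < 1\<close>; so the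
  energy is at least 1.\<close>

lemma surf_energy_ge:
  assumes U: "U \<subseteq> sites L" "card (fst ` U) < L" "card (snd ` U) < L" and c: "card U \<le> (n + 1)\<^sup>2"
    and h: "0 < h" "h < 1" "h * real n < 2" and ne: "U \<noteq> {}"
  shows "h \<le> surf_energy L h U"
proof -
  define s where "s = sqrt (real (card U))"
  have fin: "finite U" using U finite_subset finite_sites by blast
  then have "1 \<le> card U" using ne by (simp add: Suc_le_eq card_gt_0_iff)
  then have s1: "1 \<le> s" by (simp add: s_def)
  have ss: "s * s = real (card U)" by (simp add: s_def)
  have "real (card U) \<le> (real n + 1)\<^sup>2" using of_nat_mono[OF c, where 'a=real] by (simp add: add.commute)
  then have "s \<le> real n + 1" unfolding s_def by (simp add: real_le_lsqrt)
  then have "h * s \<le> h * (real n + 1)" using h by (intro mult_left_mono) auto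
  also have "\<dots> \<le> 3" using h by (simp add: algebra_simps)
  finally have hs: "h * s \<le> 3" .
  have "4 * real (card U) \<le> (real (half_per L U))\<^sup>2"
    using of_nat_mono[OF card_le_half_per_sq[OF U], where 'a=real] by simp
  then have "(2 * s)\<^sup>2 \<le> (real (half_per L U))\<^sup>2" using ss by (simp add: power2_eq_square)
  then have e: "2 * s \<le> real (half_per L U)" by (rule power2_le_imp_le) simp
  have "1 * 1 \<le> s * (4 - h * s)" using s1 hs by (intro mult_mono) auto
  also have "\<dots> = 4 * s - h * real (card U)" using ss by (simp add: algebra_simps)
  also have "\<dots> \<le> surf_energy L h U" using e by (simp add: surf_energy_def)
  finally show ?thesis using h by simp
qed

lemma card_image_mono: "finite V \<Longrightarrow> U \<subseteq> V \<Longrightarrow> card (f ` U) \<le> card (f ` V)"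
  by (simp add: card_mono image_mono)

text \<open>The third spin value occupies \<open>U\<close>. For background 0, changing -1 to 1 gains
  \<open>2 * h\<close> per site from the field and raises no gradient; for background -1,
  \<open>U\<close> is a second layer on top of \<open>V\<close> and brings its own surface
  energy.\<close>

lemma Ham_ge:
  assumes bg: "bg \<in> {-1, 0}" and s: "\<sigma> \<in> configs L"
    and V: "V = spin_set L bg \<sigma>" "card (fst ` V) < L" "card (snd ` V) < L" "card V \<le> (n + 1)\<^sup>2"
    and h: "0 < h" "h < 1" "h * real n < 2"
  shows "surf_energy L h V + (if \<sigma> = cfg L bg V then 0 else h) \<le> Ham L h \<sigma> - Ham L h (const_cfg L bg)"
proof -
  have Vs: "V \<subseteq> sites L" using V by (auto simp: spin_set_def)
  have finV: "finite V" using Vs finite_subset finite_sites by blast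
  have vals: "\<sigma> x \<in> {-1, 0, 1}" if "x \<in> sites L" for x using s that by (simp add: configs_def)
  define U where "U = {x \<in> sites L. \<sigma> x = (if bg = 0 then -1 else 1)}"
  have UV: "U \<subseteq> V" using bg by (auto simp: U_def V spin_set_def)
  then have Us: "U \<subseteq> sites L" using Vs by blast
  have iV: "indicator V x = (of_bool (\<sigma> x \<noteq> bg) :: real)"
    and iU: "indicator U x = (of_bool (\<sigma> x = (if bg = 0 then -1 else 1)) :: real)" if "x \<in> sites L" for x
    using that by (simp_all add: V spin_set_def U_def indicator_def)
  have Une: "U \<noteq> {}" if "\<sigma> \<noteq> cfg L bg V"
  proof
    assume E: "U = {}"
    have "\<sigma> x = cfg L bg V x" for x
    proof (cases "x \<in> sites L")
      case True
      then have "\<sigma> x \<noteq> (if bg = 0 then -1 else 1)" using E unfolding U_def by blast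
      then show ?thesis using True bg vals[OF True] by (auto simp: V spin_set_def cfg_def)
    next
      case False
      then have "\<sigma> x = 0" using s unfolding configs_def by blast
      then show ?thesis using False by (simp add: cfg_def)
    qed
    then show False using that by blast
  qed
  show ?thesis
  proof (cases "bg = 0")
    case True
    have v: "real_of_int (\<sigma> x) = indicator V x - 2 * indicator U x" if "x \<in> sites L" for x
      using vals[OF that] by (elim insertE emptyE; simp add: iV[OF that] iU[OF that] True)
    have "(\<Sum>x\<in>sites L. real_of_int (\<sigma> x)) = (\<Sum>x\<in>sites L. indicator V x - 2 * indicator U x)"
      by (rule sum.cong[OF refl v])
    also have "\<dots> = (\<Sum>x\<in>sites L. indicator V x) - 2 * (\<Sum>x\<in>sites L. indicator U x)"
      by (simp only: sum_subtractf sum_distrib_left)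
    finally have S: "(\<Sum>x\<in>sites L. real_of_int (\<sigma> x)) = (\<Sum>x\<in>sites L. indicator V x) - 2 * (\<Sum>x\<in>sites L. indicator U x)" .
    \<comment> \<open>Over background 0 the indicator of \<open>V\<close> is the absolute value of
      the spin, and taking absolute values is a contraction.\<close>
    have sq: "(indicator V y - indicator V x)\<^sup>2 \<le> real_of_int ((\<sigma> y - \<sigma> x)\<^sup>2)"
      if "x \<in> sites L" "y \<in> sites L" for x y
      using vals[OF that(1)] vals[OF that(2)]
      by (elim insertE emptyE; simp add: iV[OF that(1)] iV[OF that(2)] True)
    have Q: "(\<Sum>x\<in>sites L. (indicator V (right_nb L x) - indicator V x)\<^sup>2 + (indicator V (up_nb L x) - indicator V x)\<^sup>2)
       \<le> (\<Sum>x\<in>sites L. real_of_int ((\<sigma> (right_nb L x) - \<sigma> x)\<^sup>2) + real_of_int ((\<sigma> (up_nb L x) - \<sigma> x)\<^sup>2))"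
      by (intro sum_mono add_mono sq right_nb_sites up_nb_sites)
    have "surf_energy L h V + 2 * h * (\<Sum>x\<in>sites L. indicator U x) \<le> Ham L h \<sigma> - Ham L h (const_cfg L bg)"
      unfolding surf_energy_sum[OF Vs] Ham_const unfolding Ham_def S using Q True by (simp add: algebra_simps)
    moreover have "(\<Sum>x\<in>sites L. indicator U x) = real (card U)" by (rule sum_indicator_subset[OF finite_sites Us])
    moreover have "h \<le> 2 * h * real (card U)" if "U \<noteq> {}"
    proof -
      have "1 \<le> card U" using that Us finite_subset[OF Us finite_sites] by (simp add: Suc_le_eq card_gt_0_iff)
      then have "2 * h * 1 \<le> 2 * h * real (card U)" using h by (intro mult_left_mono) auto
      then show ?thesis using h by simp
    qed
    moreover have "0 \<le> 2 * h * real (card U)" using h by simp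
    ultimately show ?thesis using Une by auto
  next
    case False
    then have bg: "bg = -1" using bg by simp
    have v: "real_of_int (\<sigma> x) = real_of_int bg + (indicator V x + indicator U x)" if "x \<in> sites L" for x
      using vals[OF that] by (elim insertE emptyE; simp add: iV[OF that] iU[OF that] bg)
    have "(\<Sum>x\<in>sites L. real_of_int (\<sigma> x)) = (\<Sum>x\<in>sites L. real_of_int bg + (indicator V x + indicator U x))"
      by (rule sum.cong[OF refl v])
    also have "\<dots> = (\<Sum>x\<in>sites L. real_of_int bg)
          + ((\<Sum>x\<in>sites L. indicator V x) + (\<Sum>x\<in>sites L. indicator U x))"
      by (simp only: sum.distrib)
    finally have S: "(\<Sum>x\<in>sites L. real_of_int (\<sigma> x)) = (\<Sum>x\<in>sites L. real_of_int bg)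
          + ((\<Sum>x\<in>sites L. indicator V x) + (\<Sum>x\<in>sites L. indicator U x))" .
    \<comment> \<open>As \<open>U \<subseteq> V\<close>, the two differences never have opposite
      signs, so the mixed term of the square is nonnegative.\<close>
    have sq: "(indicator V y - indicator V x)\<^sup>2 + (indicator U y - indicator U x)\<^sup>2 \<le> real_of_int ((\<sigma> y - \<sigma> x)\<^sup>2)"
      if "x \<in> sites L" "y \<in> sites L" for x y
      using vals[OF that(1)] vals[OF that(2)]
      by (elim insertE emptyE; simp add: iV[OF that(1)] iV[OF that(2)] iU[OF that(1)] iU[OF that(2)] bg)
    have Q: "(\<Sum>x\<in>sites L. ((indicator V (right_nb L x) - indicator V x)\<^sup>2 + (indicator U (right_nb L x) - indicator U x)\<^sup>2)
            + ((indicator V (up_nb L x) - indicator V x)\<^sup>2 + (indicator U (up_nb L x) - indicator U x)\<^sup>2))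
       \<le> (\<Sum>x\<in>sites L. real_of_int ((\<sigma> (right_nb L x) - \<sigma> x)\<^sup>2) + real_of_int ((\<sigma> (up_nb L x) - \<sigma> x)\<^sup>2))"
      by (intro sum_mono add_mono sq right_nb_sites up_nb_sites)
    have "surf_energy L h V + surf_energy L h U \<le> Ham L h \<sigma> - Ham L h (const_cfg L bg)"
      unfolding surf_energy_sum[OF Vs] surf_energy_sum[OF Us] Ham_const unfolding Ham_def S
      using Q by (simp add: sum.distrib distrib_left)
    moreover have "h \<le> surf_energy L h U" if "U \<noteq> {}"
    proof (rule surf_energy_ge[OF Us _ _ _ h that])
      show "card (fst ` U) < L" "card (snd ` U) < L" "card U \<le> (n + 1)\<^sup>2"
        using V(2-4) card_mono[OF finV UV] card_image_mono[OF finV UV, of fst] card_image_mono[OF finV UV, of snd]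
        by linarith+
    qed
    ultimately show ?thesis using Une h by (cases "U = {}") auto
  qed
qed

text \<open>Subsets of subcritical sets are subcritical, so a flip that leaves the class must turn a
  background spin into another one.\<close>

lemma boundary_flip:
  assumes "subcritical n (spin_set L bg \<sigma>)" "\<not> subcritical n (spin_set L bg (flip s x \<sigma>))" "x \<in> sites L"
  shows "spin_set L bg (flip s x \<sigma>) = insert x (spin_set L bg \<sigma>)"
proof -
  let ?V = "spin_set L bg \<sigma>" and ?W = "spin_set L bg (flip s x \<sigma>)"
  have "\<not> ?W \<subseteq> ?V" using subcritical_mono[OF _ finite_spin_set assms(1)] assms(2) by blast
  then have "x \<in> ?W" using spin_set_flip by blast
  moreover have "?V - {x} \<subseteq> ?W" by (auto simp: spin_set_def flip_def)
  ultimately show ?thesis using spin_set_flip[of L bg s x \<sigma>] by blast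
qed

text \<open>An edge is weighed by its higher endpoint, so a margin at either end suffices. If for
  one ball neither end has it and no third spin value occurs, the flip completes a critical droplet,
  which \<open>nA\<close> excludes.\<close>

lemma boundary_triple:
  assumes h: "0 < h" "h < 1" "h * real n < 2" and n: "2 \<le> n" and L: "n * (n + 1) + 2 \<le> L"
    and bg: "bg \<in> {-1, 0}" and \<sigma>: "\<sigma> \<in> configs L" and x: "x \<in> sites L"
    and sub: "subcritical n (spin_set L bg \<sigma>)" and nsub: "\<not> subcritical n (spin_set L bg (flip s x \<sigma>))"
    and nA: "flip s x \<sigma> \<notin> Rl_gen L n bg (bg + 1)"
  obtains xs where "set xs \<subseteq> sites L"
    "insert x (spin_set L bg \<sigma>) \<subseteq> (\<Union>y\<in>set xs. nball L ((n + 1)\<^sup>2 * (n + 1)\<^sup>2) y)"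
    "1 \<le> length xs" "length xs \<le> (n + 1)\<^sup>2"
    "crit_energy n h + (if length xs = 1 then min h (2 - h * real n) else 2 * (real (length xs) - 1))
      \<le> max (Ham L h \<sigma>) (Ham L h (flip s x \<sigma>)) - Ham L h (const_cfg L bg)"
proof -
  let ?V = "spin_set L bg \<sigma>" and ?\<eta> = "flip s x \<sigma>"
  let ?W = "insert x ?V"
  have W: "spin_set L bg ?\<eta> = ?W" by (rule boundary_flip[OF sub nsub x])
  have nsub': "\<not> subcritical n ?W" using nsub W by simp
  note size = boundary_size[OF n L spin_set_sites sub nsub']
  have \<eta>: "?\<eta> \<in> configs L" by (rule flip_configs[OF \<sigma> x])
  have H\<eta>: "surf_energy L h ?W + (if ?\<eta> = cfg L bg ?W then 0 else h) \<le> Ham L h ?\<eta> - Ham L h (const_cfg L bg)"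
    by (rule Ham_ge[OF bg \<eta> W[symmetric] size h])
  have finW: "finite ?W" by (simp add: finite_spin_set)
  have VW: "?V \<subseteq> ?W" by blast
  have "card (fst ` ?V) < L" "card (snd ` ?V) < L" "card ?V \<le> (n + 1)\<^sup>2"
    using size card_mono[OF finW VW] card_image_mono[OF finW VW, of fst] card_image_mono[OF finW VW, of snd]
    by linarith+
  then have H\<sigma>: "surf_energy L h ?V \<le> Ham L h \<sigma> - Ham L h (const_cfg L bg)"
    using Ham_ge[OF bg \<sigma> refl _ _ _ h] h by (auto split: if_splits)
  obtain xs where xs: "set xs \<subseteq> sites L" "?W \<subseteq> (\<Union>y\<in>set xs. nball L ((n + 1)\<^sup>2 * (n + 1)\<^sup>2) y)"
    "1 \<le> length xs" "length xs \<le> (n + 1)\<^sup>2"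
    "crit_energy n h + 2 * (real (length xs) - 1) \<le> surf_energy L h ?W"
    "length xs = 1 \<longrightarrow> crit_energy n h + (2 - h * real n) \<le> surf_energy L h ?W
       \<or> crit_energy n h + h \<le> surf_energy L h ?V
       \<or> (\<exists>a b w ht. a < L \<and> b < L \<and> (w = n \<and> ht = n + 1 \<or> w = n + 1 \<and> ht = n)
            \<and> ?V = cyc L a w \<times> cyc L b ht \<and> x \<in> long_side_nbrs L a b w ht)"
    by (rule boundary_energy[OF h(1,3) n L spin_set_sites x sub nsub'])
  have "crit_energy n h + (if length xs = 1 then min h (2 - h * real n) else 2 * (real (length xs) - 1))
      \<le> max (Ham L h \<sigma>) (Ham L h (flip s x \<sigma>)) - Ham L h (const_cfg L bg)"
  proof (cases "length xs = 1")
    case False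
    then show ?thesis using xs(5) H\<eta> h by (auto split: if_splits)
  next
    case one: True
    consider (1) "crit_energy n h + (2 - h * real n) \<le> surf_energy L h ?W"
      | (2) "crit_energy n h + h \<le> surf_energy L h ?V"
      | (3) "?\<eta> \<noteq> cfg L bg ?W"
    proof -
      have False if r: "a < L" "b < L" "w = n \<and> ht = n + 1 \<or> w = n + 1 \<and> ht = n"
        "?V = cyc L a w \<times> cyc L b ht" "x \<in> long_side_nbrs L a b w ht" "?\<eta> = cfg L bg ?W" for a b w ht
      proof -
        have "x \<notin> ?V" using nsub' sub by (metis insert_absorb)
        then have "x \<notin> rect L a b w ht" "?\<eta> = (\<lambda>y. if y \<in> sites L then (if y \<in> rect L a b w ht \<union> {x} then bg + 1 else bg) else 0)"
          using r(4,6) by (auto simp: rect_cyc cfg_def)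
        then have "?\<eta> \<in> Rl_gen L n bg (bg + 1)" using r(1-3,5) unfolding Rl_gen_def by blast
        then show False using nA by blast
      qed
      then show ?thesis using that xs(6) one by blast
    qed
    then show ?thesis
    proof cases
      case 1 then show ?thesis using one H\<eta> h by (auto split: if_splits)
    next
      case 2 then show ?thesis using one H\<sigma> by auto
    next
      case 3 then show ?thesis using one H\<eta> xs(5) by auto
    qed
  qed
  then show ?thesis using that xs(1-4) by blast
qed

subsection \<open>Summation by parts for the jump chain\<close>

text \<open>The conductance of an edge: unnormalized Gibbs weight times jump rate. Its symmetry is
  the reversibility of the chain.\<close>

definition wt :: "nat \<Rightarrow> real \<Rightarrow> real \<Rightarrow> config \<Rightarrow> config \<Rightarrow> real" where
  "wt L h \<beta> \<sigma> \<eta> = exp (- \<beta> * max (Ham L h \<sigma>) (Ham L h \<eta>))"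

text \<open>Directed edges: every undirected edge occurs twice, once from each endpoint.\<close>

definition triples :: "nat \<Rightarrow> (config \<times> site \<times> bool) set" where
  "triples L = configs L \<times> sites L \<times> UNIV"

lemma finite_triples: "finite (triples L)"
  by (simp add: triples_def finite_configs)

lemma wt_pos: "0 < wt L h \<beta> \<sigma> \<eta>"
  by (simp add: wt_def)

lemma wt_commute: "wt L h \<beta> \<sigma> \<eta> = wt L h \<beta> \<eta> \<sigma>"
  by (simp add: wt_def max.commute)

lemma wt_rate: "wt L h \<beta> \<sigma> \<eta> = exp (- \<beta> * Ham L h \<sigma>) * rate L h \<beta> \<sigma> \<eta>"
proof -
  have "max (Ham L h \<sigma>) (Ham L h \<eta>) = Ham L h \<sigma> + max 0 (Ham L h \<eta> - Ham L h \<sigma>)" by simp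
  then show ?thesis by (simp only: wt_def rate_def exp_add[symmetric] distrib_left)
qed

lemma rate_pos: "0 < rate L h \<beta> \<sigma> \<eta>"
  by (simp add: rate_def)

lemma totrate_pos: "0 < L \<Longrightarrow> 0 < totrate L h \<beta> \<sigma>"
  unfolding totrate_def by (intro sum_pos) (auto simp: rate_pos sites_def)

lemma sum_jump_prob:
  assumes "0 < L"
  shows "(\<Sum>x\<in>sites L. \<Sum>s\<in>(UNIV::bool set). rate L h \<beta> \<sigma> (flip s x \<sigma>) / totrate L h \<beta> \<sigma>) = 1"
  using totrate_pos[OF assms, of h \<beta> \<sigma>]
  by (simp only: sum_divide_distrib[symmetric] totrate_def[symmetric]) simp

lemma hit_within_bounds:
  assumes "0 < L"
  shows "0 \<le> hit_within L h \<beta> A B n \<sigma> \<and> hit_within L h \<beta> A B n \<sigma> \<le> 1"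
proof (induction n arbitrary: \<sigma>)
  case (Suc n)
  let ?p = "\<lambda>s x. rate L h \<beta> \<sigma> (flip s x \<sigma>) / totrate L h \<beta> \<sigma>"
  let ?f = "\<lambda>\<eta>. if \<eta> \<in> A then 1 else if \<eta> \<in> B then 0 else hit_within L h \<beta> A B n \<eta>"
  have p: "0 \<le> ?p s x" for s x
    using rate_pos[of L h \<beta> \<sigma>] totrate_pos[OF assms, of h \<beta> \<sigma>] by (simp add: less_imp_le)
  have f: "0 \<le> ?f \<eta>" "?f \<eta> \<le> 1" for \<eta> using Suc by auto
  have "(\<Sum>x\<in>sites L. \<Sum>s\<in>(UNIV::bool set). ?p s x * ?f (flip s x \<sigma>)) \<le> (\<Sum>x\<in>sites L. \<Sum>s\<in>(UNIV::bool set). ?p s x)"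
    by (intro sum_mono mult_left_le f p)
  moreover have "0 \<le> (\<Sum>x\<in>sites L. \<Sum>s\<in>(UNIV::bool set). ?p s x * ?f (flip s x \<sigma>))"
    by (intro sum_nonneg mult_nonneg_nonneg f p)
  ultimately show ?case unfolding sum_jump_prob[OF assms] hit_within.simps by blast
qed simp

lemma hit_within_mono:
  assumes "0 < L"
  shows "hit_within L h \<beta> A B n \<sigma> \<le> hit_within L h \<beta> A B (Suc n) \<sigma>"
proof (induction n arbitrary: \<sigma>)
  case 0
  show ?case using hit_within_bounds[OF assms, of h \<beta> A B "Suc 0" \<sigma>] by (simp only: hit_within.simps(1))
next
  case (Suc n)
  have p: "0 \<le> rate L h \<beta> \<sigma> (flip s x \<sigma>) / totrate L h \<beta> \<sigma>" for s x
    using rate_pos[of L h \<beta> \<sigma>] totrate_pos[OF assms, of h \<beta> \<sigma>] by (simp add: less_imp_le)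
  let ?f = "\<lambda>m \<eta>. if \<eta> \<in> A then 1 else if \<eta> \<in> B then 0 else hit_within L h \<beta> A B m \<eta>"
  have f: "?f n \<eta> \<le> ?f (Suc n) \<eta>" for \<eta>
    using Suc[of \<eta>] by (simp del: hit_within.simps)
  have "hit_within L h \<beta> A B (Suc n) \<sigma> = (\<Sum>x\<in>sites L. \<Sum>s\<in>(UNIV::bool set).
      rate L h \<beta> \<sigma> (flip s x \<sigma>) / totrate L h \<beta> \<sigma> * ?f n (flip s x \<sigma>))"
    by (rule hit_within.simps(2))
  also have "\<dots> \<le> (\<Sum>x\<in>sites L. \<Sum>s\<in>(UNIV::bool set).
      rate L h \<beta> \<sigma> (flip s x \<sigma>) / totrate L h \<beta> \<sigma> * ?f (Suc n) (flip s x \<sigma>))"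
    by (intro sum_mono mult_left_mono p f)
  also have "\<dots> = hit_within L h \<beta> A B (Suc (Suc n)) \<sigma>"
    by (rule hit_within.simps(2)[symmetric])
  finally show ?case .
qed

lemma hit_within_tendsto:
  assumes "0 < L"
  shows "(\<lambda>n. hit_within L h \<beta> A B n \<sigma>) \<longlonglongrightarrow> hit_before L h \<beta> A B \<sigma>"
  unfolding hit_before_def
proof (rule LIMSEQ_incseq_SUP)
  show "bdd_above (range (\<lambda>n. hit_within L h \<beta> A B n \<sigma>))"
    using hit_within_bounds[OF assms] by (intro bdd_aboveI[of _ 1]) auto
  show "incseq (\<lambda>n. hit_within L h \<beta> A B n \<sigma>)"
    using hit_within_mono[OF assms] by (intro incseq_SucI)
qed

lemma hit_before_bounds:
  assumes "0 < L"
  shows "0 \<le> hit_before L h \<beta> A B \<sigma>" "hit_before L h \<beta> A B \<sigma> \<le> 1"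
proof -
  show "0 \<le> hit_before L h \<beta> A B \<sigma>"
    by (rule LIMSEQ_le_const[OF hit_within_tendsto[OF assms]]) (use hit_within_bounds[OF assms] in blast)
  show "hit_before L h \<beta> A B \<sigma> \<le> 1"
    by (rule LIMSEQ_le_const2[OF hit_within_tendsto[OF assms]]) (use hit_within_bounds[OF assms] in blast)
qed

text \<open>The recursion for finitely many jumps passes to the limit, since the sum over the
  neighbours is finite.\<close>

lemma hit_before_harmonic:
  assumes "0 < L"
  shows "hit_before L h \<beta> A B \<sigma> =
     (\<Sum>x\<in>sites L. \<Sum>s\<in>(UNIV::bool set). rate L h \<beta> \<sigma> (flip s x \<sigma>) / totrate L h \<beta> \<sigma> *
        (if flip s x \<sigma> \<in> A then 1 else if flip s x \<sigma> \<in> B then 0 else hit_before L h \<beta> A B (flip s x \<sigma>)))"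
proof (rule LIMSEQ_unique)
  show "(\<lambda>n. hit_within L h \<beta> A B (Suc n) \<sigma>) \<longlonglongrightarrow> hit_before L h \<beta> A B \<sigma>"
    by (rule LIMSEQ_Suc[OF hit_within_tendsto[OF assms]])
  have "(\<lambda>n. if \<eta> \<in> A then 1 else if \<eta> \<in> B then 0 else hit_within L h \<beta> A B n \<eta>)
     \<longlonglongrightarrow> (if \<eta> \<in> A then 1 else if \<eta> \<in> B then 0 else hit_before L h \<beta> A B \<eta>)" for \<eta>
    using hit_within_tendsto[OF assms] by simp
  then show "(\<lambda>n. hit_within L h \<beta> A B (Suc n) \<sigma>) \<longlonglongrightarrow>
     (\<Sum>x\<in>sites L. \<Sum>s\<in>(UNIV::bool set). rate L h \<beta> \<sigma> (flip s x \<sigma>) / totrate L h \<beta> \<sigma> *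
        (if flip s x \<sigma> \<in> A then 1 else if flip s x \<sigma> \<in> B then 0 else hit_before L h \<beta> A B (flip s x \<sigma>)))"
    unfolding hit_within.simps by (intro tendsto_sum tendsto_mult tendsto_const)
qed

text \<open>The values on \<open>A\<close> and \<open>B\<close> are imposed, because
  \<open>hit_before\<close> counts only hits after a jump and ignores where the chain starts.
  Hitting neither set also counts as missing.\<close>

definition miss :: "nat \<Rightarrow> real \<Rightarrow> real \<Rightarrow> config set \<Rightarrow> config set \<Rightarrow> config \<Rightarrow> real" where
  "miss L h \<beta> A B \<sigma> = (if \<sigma> \<in> A then 0 else if \<sigma> \<in> B then 1 else 1 - hit_before L h \<beta> A B \<sigma>)"

lemma miss_bounds: "0 < L \<Longrightarrow> 0 \<le> miss L h \<beta> A B \<sigma>" "0 < L \<Longrightarrow> miss L h \<beta> A B \<sigma> \<le> 1"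
  using hit_before_bounds[of L h \<beta> A B \<sigma>] by (auto simp: miss_def)

text \<open>Multiplying the one-step equation by \<open>totrate\<close> and the Gibbs weight turns
  jump probabilities into symmetric conductances.\<close>

lemma miss_harmonic:
  assumes L: "0 < L" and \<sigma>: "\<sigma> \<notin> A" "\<sigma> \<notin> B"
  shows "(\<Sum>x\<in>sites L. \<Sum>s\<in>(UNIV::bool set). wt L h \<beta> \<sigma> (flip s x \<sigma>) *
           (miss L h \<beta> A B (flip s x \<sigma>) - miss L h \<beta> A B \<sigma>)) = 0"
proof -
  let ?r = "\<lambda>x s. rate L h \<beta> \<sigma> (flip s x \<sigma>)" and ?T = "totrate L h \<beta> \<sigma>"
  let ?f = "\<lambda>\<eta>. if \<eta> \<in> A then 1 else if \<eta> \<in> B then 0 else hit_before L h \<beta> A B \<eta>"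
  have f: "miss L h \<beta> A B \<eta> = 1 - ?f \<eta>" for \<eta> by (simp add: miss_def)
  have m: "miss L h \<beta> A B (flip s x \<sigma>) - miss L h \<beta> A B \<sigma> = hit_before L h \<beta> A B \<sigma> - ?f (flip s x \<sigma>)" for s x
    unfolding f using \<sigma> by simp
  have clear: "X = u * t" if "u = X / t" "0 < t" for X u t :: real
    using that by simp
  have "hit_before L h \<beta> A B \<sigma> = (\<Sum>x\<in>sites L. \<Sum>s\<in>(UNIV::bool set). ?r x s * ?f (flip s x \<sigma>)) / ?T"
    by (subst hit_before_harmonic[OF L]) (simp only: sum_divide_distrib times_divide_eq_left)
  then have e: "(\<Sum>x\<in>sites L. \<Sum>s\<in>(UNIV::bool set). ?r x s * ?f (flip s x \<sigma>)) = hit_before L h \<beta> A B \<sigma> * ?T"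
    by (rule clear[OF _ totrate_pos[OF L]])
  have "(\<Sum>x\<in>sites L. \<Sum>s\<in>(UNIV::bool set). ?r x s * (hit_before L h \<beta> A B \<sigma> - ?f (flip s x \<sigma>)))
      = (\<Sum>x\<in>sites L. \<Sum>s\<in>(UNIV::bool set). ?r x s) * hit_before L h \<beta> A B \<sigma>
        - (\<Sum>x\<in>sites L. \<Sum>s\<in>(UNIV::bool set). ?r x s * ?f (flip s x \<sigma>))"
    by (simp only: right_diff_distrib sum_subtractf sum_distrib_right)
  also have "\<dots> = 0" unfolding e totrate_def by simp
  finally show ?thesis
    unfolding wt_rate m by (simp only: mult.assoc sum_distrib_left[symmetric] mult_zero_right)
qed

definition reverse_triple :: "config \<times> site \<times> bool \<Rightarrow> config \<times> site \<times> bool" where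
  "reverse_triple = (\<lambda>(\<sigma>, x, s). (flip s x \<sigma>, x, \<not> s))"

text \<open>Reversing a directed edge is an involution: opposite shifts modulo 3 at the same site
  undo each other.\<close>

lemma sum_reverse:
  "(\<Sum>(\<sigma>, x, s)\<in>triples L. f \<sigma> (flip s x \<sigma>) :: real) = (\<Sum>(\<sigma>, x, s)\<in>triples L. f (flip s x \<sigma>) \<sigma>)"
proof -
  have inv: "reverse_triple t \<in> triples L" "reverse_triple (reverse_triple t) = t" if "t \<in> triples L" for t
    using that flip_configs flip_flip by (cases t; force simp: triples_def reverse_triple_def)+
  show ?thesis
  proof (rule sum.reindex_bij_witness[of _ reverse_triple reverse_triple])
    fix t assume t: "t \<in> triples L"
    then show "(case reverse_triple t of (\<sigma>, x, s) \<Rightarrow> f (flip s x \<sigma>) \<sigma>) = (case t of (\<sigma>, x, s) \<Rightarrow> f \<sigma> (flip s x \<sigma>))"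
      using flip_flip[of "fst t" L "fst (snd t)" "snd (snd t)"] by (simp add: triples_def reverse_triple_def case_prod_beta mem_Times_iff)
  qed (use inv in blast)+
qed

text \<open>Summation by parts against the cut-off of the harmonic function \<open>miss\<close> at the set \<open>S\<close>;
  edges from \<open>S\<close> into \<open>A\<close> may be discarded because \<open>miss\<close> vanishes there.\<close>
lemma dirichlet_bound:
  fixes h \<beta> :: real and A B :: "config set" and S :: "config \<Rightarrow> bool"
  assumes L: "0 < L" and B: "\<And>\<sigma>. \<sigma> \<in> B \<Longrightarrow> \<not> S \<sigma>"
  defines "g \<equiv> miss L h \<beta> A B"
  defines "\<phi> \<equiv> (\<lambda>\<sigma>. if S \<sigma> then g \<sigma> else 0)"
  shows "(\<Sum>(\<sigma>, x, s)\<in>triples L. wt L h \<beta> \<sigma> (flip s x \<sigma>) * (\<phi> (flip s x \<sigma>) - \<phi> \<sigma>)\<^sup>2)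
    \<le> 2 * (\<Sum>(\<sigma>, x, s)\<in>{(\<sigma>, x, s) \<in> triples L. S \<sigma> \<and> \<not> S (flip s x \<sigma>) \<and> flip s x \<sigma> \<notin> A}. wt L h \<beta> \<sigma> (flip s x \<sigma>))"
proof -
  let ?w = "wt L h \<beta>"
  have g: "0 \<le> g \<sigma>" "g \<sigma> \<le> 1" for \<sigma> unfolding g_def using miss_bounds[OF L] by auto
  \<comment> \<open>\<open>\<phi>\<close> vanishes on \<open>A\<close> because of \<open>g\<close>
    and on \<open>B\<close> because of \<open>S\<close>, so it tests \<open>g\<close> only where
    \<open>g\<close> is harmonic.\<close>
  have zero: "(\<Sum>(\<sigma>, x, s)\<in>triples L. ?w \<sigma> (flip s x \<sigma>) * (\<phi> \<sigma> * (g (flip s x \<sigma>) - g \<sigma>))) = 0"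
  proof -
    have "(\<Sum>(\<sigma>, x, s)\<in>triples L. ?w \<sigma> (flip s x \<sigma>) * (\<phi> \<sigma> * (g (flip s x \<sigma>) - g \<sigma>)))
        = (\<Sum>\<sigma>\<in>configs L. \<Sum>x\<in>sites L. \<Sum>s\<in>UNIV. ?w \<sigma> (flip s x \<sigma>) * (\<phi> \<sigma> * (g (flip s x \<sigma>) - g \<sigma>)))"
      unfolding triples_def by (simp only: sum.cartesian_product)
    also have "\<dots> = (\<Sum>\<sigma>\<in>configs L. \<phi> \<sigma> * (\<Sum>x\<in>sites L. \<Sum>s\<in>UNIV. ?w \<sigma> (flip s x \<sigma>) * (g (flip s x \<sigma>) - g \<sigma>)))"
      by (simp only: sum_distrib_left mult.left_commute)
    also have "\<dots> = 0"
    proof (rule sum.neutral, rule ballI)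
      fix \<sigma> assume "\<sigma> \<in> configs L"
      show "\<phi> \<sigma> * (\<Sum>x\<in>sites L. \<Sum>s\<in>UNIV. ?w \<sigma> (flip s x \<sigma>) * (g (flip s x \<sigma>) - g \<sigma>)) = 0"
      proof (cases "\<sigma> \<in> A \<or> \<sigma> \<in> B")
        case True
        then have "\<phi> \<sigma> = 0" using B by (auto simp: \<phi>_def g_def miss_def)
        then show ?thesis by simp
      next
        case False
        then show ?thesis unfolding g_def using miss_harmonic[OF L] by simp
      qed
    qed
    finally show ?thesis .
  qed
  have "(\<Sum>(\<sigma>, x, s)\<in>triples L. ?w \<sigma> (flip s x \<sigma>) * (\<phi> (flip s x \<sigma>) * (g (flip s x \<sigma>) - g \<sigma>)))
      = (\<Sum>(\<sigma>, x, s)\<in>triples L. ?w (flip s x \<sigma>) \<sigma> * (\<phi> \<sigma> * (g \<sigma> - g (flip s x \<sigma>))))"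
    by (rule sum_reverse[of "\<lambda>\<sigma> \<eta>. ?w \<sigma> \<eta> * (\<phi> \<eta> * (g \<eta> - g \<sigma>))"])
  also have "\<dots> = - (\<Sum>(\<sigma>, x, s)\<in>triples L. ?w \<sigma> (flip s x \<sigma>) * (\<phi> \<sigma> * (g (flip s x \<sigma>) - g \<sigma>)))"
    unfolding sum_negf[symmetric] by (rule sum.cong) (auto simp: wt_commute algebra_simps)
  finally have zero': "(\<Sum>(\<sigma>, x, s)\<in>triples L. ?w \<sigma> (flip s x \<sigma>) * (\<phi> (flip s x \<sigma>) * (g (flip s x \<sigma>) - g \<sigma>))) = 0"
    using zero by simp
  define b where "b \<sigma> \<eta> = ?w \<sigma> \<eta> * of_bool (S \<sigma> \<and> \<not> S \<eta> \<and> \<eta> \<notin> A)" for \<sigma> \<eta>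
  \<comment> \<open>On an edge that leaves \<open>S\<close> the square exceeds the product of
    gradients by \<open>g \<sigma> * g \<eta>\<close>, which is at most 1 and is 0 if the outer end
    is in \<open>A\<close>. Other edges need no correction.\<close>
  have pt: "?w \<sigma> \<eta> * (\<phi> \<eta> - \<phi> \<sigma>)\<^sup>2 \<le> ?w \<sigma> \<eta> * (\<phi> \<eta> * (g \<eta> - g \<sigma>)) - ?w \<sigma> \<eta> * (\<phi> \<sigma> * (g \<eta> - g \<sigma>)) + b \<sigma> \<eta> + b \<eta> \<sigma>"
    for \<sigma> \<eta>
  proof -
    have A0: "g \<eta> = 0" if "\<eta> \<in> A" for \<eta> using that by (simp add: g_def miss_def)
    have gg: "g \<sigma> * g \<eta> \<le> 1" using g[of \<sigma>] g[of \<eta>] mult_le_one by blast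
    have "(\<phi> \<eta> - \<phi> \<sigma>)\<^sup>2 \<le> \<phi> \<eta> * (g \<eta> - g \<sigma>) - \<phi> \<sigma> * (g \<eta> - g \<sigma>)
        + of_bool (S \<sigma> \<and> \<not> S \<eta> \<and> \<eta> \<notin> A) + of_bool (S \<eta> \<and> \<not> S \<sigma> \<and> \<sigma> \<notin> A)"
      using gg A0[of \<sigma>] A0[of \<eta>]
      by (cases "S \<sigma>"; cases "S \<eta>"; cases "\<sigma> \<in> A"; cases "\<eta> \<in> A") (simp_all add: \<phi>_def power2_eq_square algebra_simps)
    then have "?w \<sigma> \<eta> * (\<phi> \<eta> - \<phi> \<sigma>)\<^sup>2 \<le> ?w \<sigma> \<eta> * (\<phi> \<eta> * (g \<eta> - g \<sigma>) - \<phi> \<sigma> * (g \<eta> - g \<sigma>)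
        + of_bool (S \<sigma> \<and> \<not> S \<eta> \<and> \<eta> \<notin> A) + of_bool (S \<eta> \<and> \<not> S \<sigma> \<and> \<sigma> \<notin> A))"
      by (rule mult_left_mono) (simp add: wt_def)
    then show ?thesis unfolding b_def wt_commute[of L h \<beta> \<eta> \<sigma>] by (simp only: distrib_left right_diff_distrib)
  qed
  have "(\<Sum>(\<sigma>, x, s)\<in>triples L. ?w \<sigma> (flip s x \<sigma>) * (\<phi> (flip s x \<sigma>) - \<phi> \<sigma>)\<^sup>2)
     \<le> (\<Sum>(\<sigma>, x, s)\<in>triples L. ?w \<sigma> (flip s x \<sigma>) * (\<phi> (flip s x \<sigma>) * (g (flip s x \<sigma>) - g \<sigma>))
        - ?w \<sigma> (flip s x \<sigma>) * (\<phi> \<sigma> * (g (flip s x \<sigma>) - g \<sigma>)) + b \<sigma> (flip s x \<sigma>) + b (flip s x \<sigma>) \<sigma>)"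
    unfolding case_prod_beta by (intro sum_mono pt)
  also have "\<dots> = (\<Sum>(\<sigma>, x, s)\<in>triples L. b \<sigma> (flip s x \<sigma>)) + (\<Sum>(\<sigma>, x, s)\<in>triples L. b (flip s x \<sigma>) \<sigma>)"
    using zero zero' by (simp add: case_prod_beta sum.distrib sum_subtractf)
  also have "(\<Sum>(\<sigma>, x, s)\<in>triples L. b (flip s x \<sigma>) \<sigma>) = (\<Sum>(\<sigma>, x, s)\<in>triples L. b \<sigma> (flip s x \<sigma>))"
    by (rule sum_reverse[symmetric])
  also have "(\<Sum>(\<sigma>, x, s)\<in>triples L. b \<sigma> (flip s x \<sigma>))
     = (\<Sum>(\<sigma>, x, s)\<in>{(\<sigma>, x, s) \<in> triples L. S \<sigma> \<and> \<not> S (flip s x \<sigma>) \<and> flip s x \<sigma> \<notin> A}. ?w \<sigma> (flip s x \<sigma>))"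
    by (rule sum.mono_neutral_cong_right) (auto simp: finite_triples b_def)
  finally show ?thesis by simp
qed

text \<open>By Cauchy-Schwarz along a path, \<open>G\<^sup>2\<close> is at most \<open>N\<close>
  times the sum of squared increments. The injectivity makes all edges distinct, so the
  contributions of the paths add up to at most the full sum.\<close>

lemma path_bound:
  fixes \<phi> :: "config \<Rightarrow> real"
  assumes J: "finite J" and N: "0 < N"
    and step: "\<And>j i. j \<in> J \<Longrightarrow> i < N \<Longrightarrow> P j (Suc i) = flip True (z j i) (P j i)"
    and mem: "\<And>j i. j \<in> J \<Longrightarrow> i < N \<Longrightarrow> P j i \<in> configs L \<and> z j i \<in> sites L"
    and inj: "inj_on (\<lambda>(j, i). (P j i, z j i)) (J \<times> {..<N})"
    and w: "\<And>j i. j \<in> J \<Longrightarrow> i < N \<Longrightarrow> w0 \<le> wt L h \<beta> (P j i) (P j (Suc i))" and w0: "0 \<le> w0"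
    and ends: "\<And>j. j \<in> J \<Longrightarrow> \<phi> (P j 0) = G \<and> \<phi> (P j N) = 0"
  shows "real (card J) * w0 * G\<^sup>2 \<le> real N *
    (\<Sum>(\<sigma>, x, s)\<in>triples L. wt L h \<beta> \<sigma> (flip s x \<sigma>) * (\<phi> (flip s x \<sigma>) - \<phi> \<sigma>)\<^sup>2)"
proof -
  let ?F = "\<lambda>(\<sigma>, x, s). wt L h \<beta> \<sigma> (flip s x \<sigma>) * (\<phi> (flip s x \<sigma>) - \<phi> \<sigma>)\<^sup>2"
  let ?e = "\<lambda>(j, i). (P j i, z j i, True)"
  have one: "w0 * G\<^sup>2 \<le> real N * (\<Sum>i<N. ?F (?e (j, i)))" if j: "j \<in> J" for j
  proof -
    have "(\<Sum>i<N. \<phi> (P j (Suc i)) - \<phi> (P j i)) = - G"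
      using ends[OF j] by (subst sum_lessThan_telescope) simp
    then have "G\<^sup>2 = (\<Sum>i<N. (\<phi> (P j (Suc i)) - \<phi> (P j i)) * 1)\<^sup>2" by simp
    also have "\<dots> \<le> (\<Sum>i<N. (\<phi> (P j (Suc i)) - \<phi> (P j i))\<^sup>2) * (\<Sum>i<N. 1\<^sup>2)"
      by (rule Cauchy_Schwarz_ineq_sum)
    finally have "w0 * G\<^sup>2 \<le> w0 * (real N * (\<Sum>i<N. (\<phi> (P j (Suc i)) - \<phi> (P j i))\<^sup>2))"
      using w0 by (intro mult_left_mono) (simp_all add: mult.commute)
    also have "\<dots> = real N * (\<Sum>i<N. w0 * (\<phi> (P j (Suc i)) - \<phi> (P j i))\<^sup>2)"
      by (simp only: sum_distrib_left mult.left_commute)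
    also have "\<dots> \<le> real N * (\<Sum>i<N. ?F (?e (j, i)))"
    proof (intro mult_left_mono sum_mono)
      fix i assume "i \<in> {..<N}"
      then have "i < N" by simp
      show "w0 * (\<phi> (P j (Suc i)) - \<phi> (P j i))\<^sup>2 \<le> ?F (?e (j, i))"
        using w[OF j \<open>i < N\<close>] step[OF j \<open>i < N\<close>] by (simp add: mult_right_mono)
    qed simp
    finally show ?thesis .
  qed
  have "real (card J) * w0 * G\<^sup>2 = (\<Sum>j\<in>J. w0 * G\<^sup>2)" by simp
  also have "\<dots> \<le> (\<Sum>j\<in>J. real N * (\<Sum>i<N. ?F (?e (j, i))))" by (rule sum_mono[OF one])
  also have "\<dots> = real N * (\<Sum>(j, i)\<in>J \<times> {..<N}. ?F (?e (j, i)))"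
    by (simp only: sum_distrib_left[symmetric] sum.cartesian_product)
  also have "(\<Sum>(j, i)\<in>J \<times> {..<N}. ?F (?e (j, i))) = sum ?F (?e ` (J \<times> {..<N}))"
  proof (subst sum.reindex)
    show "inj_on ?e (J \<times> {..<N})" using inj by (auto simp: inj_on_def)
  qed (auto intro!: sum.cong)
  also have "sum ?F (?e ` (J \<times> {..<N})) \<le> sum ?F (triples L)"
    by (rule sum_mono2[OF finite_triples]) (use mem in \<open>auto simp: triples_def less_imp_le[OF wt_pos]\<close>)
  finally show ?thesis using N by (simp add: mult_left_mono)
qed

subsection \<open>Paths to the critical droplets\<close>

text \<open>Fills \<open>n + 1\<close> rows of length \<open>n\<close> from the bottom. The final
  offset \<open>(n, 0)\<close> is to the right of the bottom row, hence on a side of length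
  \<open>n + 1\<close>.\<close>

definition fill_offset :: "nat \<Rightarrow> nat \<Rightarrow> nat \<times> nat" where
  "fill_offset n i = (if i < n * (n + 1) then (i mod n, i div n) else (n, 0))"

definition fill_site :: "nat \<Rightarrow> nat \<Rightarrow> site \<Rightarrow> nat \<Rightarrow> site" where
  "fill_site L n c i = ((fst c + fst (fill_offset n i)) mod L, (snd c + snd (fill_offset n i)) mod L)"

definition fill_set :: "nat \<Rightarrow> nat \<Rightarrow> site \<Rightarrow> nat \<Rightarrow> site set" where
  "fill_set L n c i = fill_site L n c ` {..<i}"

lemma add_mod_cancel:
  assumes "(a + i) mod L = (a + j) mod L" "i < L" "j < L"
  shows "i = (j::nat)"
proof -
  have "[i = j] (mod L)" using assms(1) by (simp add: cong_def[symmetric] cong_add_lcancel_nat)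
  then show ?thesis using assms by (simp add: cong_def)
qed

lemma add_mod_cancel_right:
  assumes "(i + a) mod L = (j + a) mod L" "i < L" "j < L"
  shows "i = (j::nat)"
  using add_mod_cancel[of a i L j] assms by (simp add: add.commute)

lemma fill_offset_le:
  assumes "2 \<le> n"
  shows "fst (fill_offset n i) \<le> n" "snd (fill_offset n i) \<le> n"
proof -
  have "i mod n < n" using assms by simp
  moreover have "i div n \<le> n" if "i < n * (n + 1)"
    using that by (metis less_mult_imp_div_less mult.commute Suc_eq_plus1 less_Suc_eq_le)
  ultimately show "fst (fill_offset n i) \<le> n" "snd (fill_offset n i) \<le> n"
    by (auto simp: fill_offset_def)
qed

lemma inj_fill_offset:
  assumes "2 \<le> n"
  shows "inj_on (fill_offset n) {..n * (n + 1)}"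
proof (rule inj_onI)
  fix i j assume ij: "i \<in> {..n * (n + 1)}" "j \<in> {..n * (n + 1)}" and e: "fill_offset n i = fill_offset n j"
  have m: "i mod n \<noteq> n" "j mod n \<noteq> n" using assms by (metis mod_less_divisor nat_neq_iff not_numeral_le_zero gr0I)+
  show "i = j"
  proof (cases "i < n * (n + 1) \<and> j < n * (n + 1)")
    case True
    then have "i mod n = j mod n" "i div n = j div n" using e by (auto simp: fill_offset_def)
    then show ?thesis by (metis div_mult_mod_eq)
  next
    case False
    then show ?thesis using e m ij unfolding fill_offset_def
      by (metis Pair_inject atMost_iff linorder_neqE_nat not_less)
  qed
qed

lemma inj_fill_site:
  assumes n: "2 \<le> n" and L: "n + 4 < L"
  shows "inj_on (fill_site L n c) {..n * (n + 1)}"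
proof (rule inj_onI)
  fix i j assume ij: "i \<in> {..n * (n + 1)}" "j \<in> {..n * (n + 1)}" and e: "fill_site L n c i = fill_site L n c j"
  have "fst (fill_offset n i) = fst (fill_offset n j)" "snd (fill_offset n i) = snd (fill_offset n j)"
    using e add_mod_cancel[of "fst c" "fst (fill_offset n i)" L "fst (fill_offset n j)"]
      add_mod_cancel[of "snd c" "snd (fill_offset n i)" L "snd (fill_offset n j)"]
      fill_offset_le[OF n, of i] fill_offset_le[OF n, of j] L
    by (simp_all add: fill_site_def)
  then have "fill_offset n i = fill_offset n j" by (rule prod_eqI)
  then show "i = j" using inj_onD[OF inj_fill_offset[OF n]] ij by blast
qed

lemma fill_site_new:
  assumes n: "2 \<le> n" and L: "n + 4 < L" and i: "i \<le> n * (n + 1)"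
  shows "fill_site L n c i \<notin> fill_set L n c i"
proof
  assume "fill_site L n c i \<in> fill_set L n c i"
  then obtain j where "j < i" "fill_site L n c i = fill_site L n c j" by (auto simp: fill_set_def)
  then show False using inj_onD[OF inj_fill_site[OF n L], of c i j] i by simp
qed

lemma fill_set_Suc: "fill_set L n c (Suc i) = insert (fill_site L n c i) (fill_set L n c i)"
  by (simp add: fill_set_def lessThan_Suc)

lemma fill_set_0: "fill_set L n c 0 = {}"
  by (simp add: fill_set_def)

lemma fill_site_sites: "0 < L \<Longrightarrow> fill_site L n c i \<in> sites L"
  by (simp add: fill_site_def sites_def)

lemma fill_set_sites: "0 < L \<Longrightarrow> fill_set L n c i \<subseteq> sites L"
  unfolding fill_set_def by (rule image_subsetI, rule fill_site_sites)

lemma card_fill_set: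
  assumes n: "2 \<le> n" and L: "n + 4 < L" and i: "i \<le> n * (n + 1) + 1"
  shows "card (fill_set L n c i) = i"
proof -
  have "{..<i} \<subseteq> {..n * (n + 1)}" using i by auto
  then have "inj_on (fill_site L n c) {..<i}" using inj_fill_site[OF n L] inj_on_subset by blast
  then show ?thesis by (simp add: fill_set_def card_image)
qed

text \<open>An \<open>l\<close> with \<open>f l = x\<close> stops being an exit, which pays for the
  possible new exit at \<open>x\<close>.\<close>

lemma exits_insert:
  assumes "finite V" "x \<notin> V"
  shows "exits f (insert x V) \<le> exits f V + (if \<exists>l\<in>V. f l = x then 0 else 1)"
proof (cases "\<exists>l\<in>V. f l = x")
  case True
  then obtain l where l: "l \<in> V" "f l = x" by blast
  have fin: "finite {y \<in> V. f y \<notin> V}" using assms by simp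
  have lm: "l \<in> {y \<in> V. f y \<notin> V}" using l assms by simp
  have "{y \<in> insert x V. f y \<notin> insert x V} \<subseteq> insert x ({y \<in> V. f y \<notin> V} - {l})"
    using l by blast
  then have "card {y \<in> insert x V. f y \<notin> insert x V} \<le> card (insert x ({y \<in> V. f y \<notin> V} - {l}))"
    using fin by (intro card_mono) auto
  also have "\<dots> \<le> Suc (card ({y \<in> V. f y \<notin> V} - {l}))" by (rule card_insert_le_Suc)
  also have "\<dots> = card {y \<in> V. f y \<notin> V}" by (rule card_Suc_Diff1[OF fin lm])
  finally show ?thesis using True by (simp add: exits_def)
next
  case False
  have "{y \<in> insert x V. f y \<notin> insert x V} \<subseteq> insert x {y \<in> V. f y \<notin> V}" by blast
  then have "card {y \<in> insert x V. f y \<notin> insert x V} \<le> card (insert x {y \<in> V. f y \<notin> V})"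
    using assms by (intro card_mono) auto
  also have "\<dots> \<le> Suc (card {y \<in> V. f y \<notin> V})" by (rule card_insert_le_Suc)
  finally show ?thesis using False by (simp add: exits_def)
qed

lemma half_per_insert:
  assumes "finite V" "x \<notin> V"
  shows "half_per L (insert x V) \<le> half_per L V
     + ((if \<exists>l\<in>V. right_nb L l = x then 0 else 1) + (if \<exists>l\<in>V. up_nb L l = x then 0 else 1))"
  using exits_insert[OF assms, of "right_nb L"] exits_insert[OF assms, of "up_nb L"]
  unfolding half_per_def by linarith

lemma fill_left:
  assumes "fill_offset n j = (a, b)" "fill_offset n i = (Suc a, b)" "j < i"
  shows "\<exists>l\<in>fill_set L n c i. right_nb L l = fill_site L n c i"
proof
  show "fill_site L n c j \<in> fill_set L n c i" using assms(3) by (simp add: fill_set_def)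
  show "right_nb L (fill_site L n c j) = fill_site L n c i"
    using assms(1,2) by (simp add: fill_site_def right_nb_def mod_Suc_eq)
qed

lemma fill_down:
  assumes "fill_offset n j = (a, b)" "fill_offset n i = (a, Suc b)" "j < i"
  shows "\<exists>l\<in>fill_set L n c i. up_nb L l = fill_site L n c i"
proof
  show "fill_site L n c j \<in> fill_set L n c i" using assms(3) by (simp add: fill_set_def)
  show "up_nb L (fill_site L n c j) = fill_site L n c i"
    using assms(1,2) by (simp add: fill_site_def up_nb_def mod_Suc_eq)
qed

text \<open>A site that does not start a row has a filled left neighbour, and one above the first
  row a filled lower neighbour; each of them saves one exit. The bound is width plus height of the
  part filled so far.\<close>

lemma half_per_fill:
  assumes n: "2 \<le> n" and L: "n + 4 < L"
  shows "i < n * (n + 1) \<Longrightarrow> half_per L (fill_set L n c (Suc i)) \<le> (if i < n then i + 2 else n + i div n + 1)"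
proof (induction i)
  case 0
  have "half_per L (insert (fill_site L n c 0) {}) \<le> half_per L {} + (1 + 1)"
    using half_per_insert[of "{}" "fill_site L n c 0" L] by simp
  then show ?case using n by (simp add: fill_set_Suc fill_set_0 half_per_def exits_def)
next
  case (Suc i)
  define k where "k = Suc i"
  have k: "0 < k" "k < n * (n + 1)" "i = k - 1" using Suc.prems by (auto simp: k_def)
  have fin: "finite (fill_set L n c k)" by (simp add: fill_set_def)
  have new: "fill_site L n c k \<notin> fill_set L n c k" using fill_site_new[OF n L] k by simp
  have left: "\<exists>l\<in>fill_set L n c k. right_nb L l = fill_site L n c k" if "k mod n \<noteq> 0"
  proof (rule fill_left[of n "k - 1" "k mod n - 1" "k div n"])
    have "(k - 1) mod n = k mod n - 1" "(k - 1) div n = k div n"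
      using that k(1) by (metis Suc_pred' mod_Suc diff_Suc_1 mod_0, metis Suc_pred' div_Suc mod_Suc)
    then show "fill_offset n (k - 1) = (k mod n - 1, k div n)" using k by (simp add: fill_offset_def)
    show "fill_offset n k = (Suc (k mod n - 1), k div n)" using k that by (simp add: fill_offset_def)
  qed (use k in simp)
  have down: "\<exists>l\<in>fill_set L n c k. up_nb L l = fill_site L n c k" if "n \<le> k"
  proof (rule fill_down[of n "k - n" "k mod n" "k div n - 1"])
    show "fill_offset n (k - n) = (k mod n, k div n - 1)" using k that n
      by (simp add: fill_offset_def le_mod_geq le_div_geq)
    show "fill_offset n k = (k mod n, Suc (k div n - 1))" using k that n
      by (simp add: fill_offset_def le_div_geq)
  qed (use k n in simp)
  have IH: "half_per L (fill_set L n c k) \<le> (if i < n then i + 2 else n + i div n + 1)"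
    using Suc by (simp add: k_def)
  have ins: "half_per L (fill_set L n c (Suc k)) \<le> half_per L (fill_set L n c k)
     + ((if \<exists>l\<in>fill_set L n c k. right_nb L l = fill_site L n c k then 0 else 1)
       + (if \<exists>l\<in>fill_set L n c k. up_nb L l = fill_site L n c k then 0 else 1))"
    unfolding fill_set_Suc by (rule half_per_insert[OF fin new])
  have "half_per L (fill_set L n c (Suc k)) \<le> (if k < n then k + 2 else n + k div n + 1)"
  proof (cases "k < n")
    case True
    then have "k mod n \<noteq> 0" using k by simp
    then have "half_per L (fill_set L n c (Suc k)) \<le> half_per L (fill_set L n c k) + 1"
      using ins left by (simp split: if_splits)
    then show ?thesis using IH True by (simp add: k_def)
  next
    case False
    then have d: "half_per L (fill_set L n c (Suc k)) \<le> half_per L (fill_set L n c k) + (if k mod n \<noteq> 0 then 0 else 1)"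
      using ins left down by (cases "k mod n = 0") (simp_all split: if_splits)
    show ?thesis
    proof (cases "k mod n = 0")
      case True
      have kd: "k div n = Suc (i div n)" using True by (simp add: k_def div_Suc)
      have "half_per L (fill_set L n c k) \<le> n + i div n + 1"
      proof (cases "i < n")
        case True
        then have "i + 2 = n + i div n + 1" using False by (simp add: k_def)
        then show ?thesis using IH True by simp
      qed (use IH in simp)
      then show ?thesis using d True False kd by simp
    next
      case nz: False
      have kd: "k div n = i div n" using nz by (simp add: k_def div_Suc)
      have "\<not> i < n" using False nz by (metis k_def less_antisym mod_self not_less_eq)
      then show ?thesis using d IH nz False kd by simp
    qed
  qed
  then show ?case unfolding k_def .
qed

lemma half_per_fill_last:
  assumes n: "2 \<le> n" and L: "n + 4 < L"
  shows "half_per L (fill_set L n c (Suc (n * (n + 1)))) \<le> 2 * n + 2"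
proof -
  let ?N = "n * (n + 1)"
  have N: "2 * (n + 1) \<le> ?N" using n by (rule mult_le_mono1)
  have "(?N - 1) div n = n"
  proof -
    have e: "?N - 1 = (n - 1) + n * n" using n by simp
    show ?thesis unfolding e using n by (subst div_mult_self2) simp_all
  qed
  moreover have "\<not> ?N - 1 < n" using N n by arith
  moreover have "?N - 1 < ?N" using N n by arith
  ultimately have "half_per L (fill_set L n c (Suc (?N - 1))) \<le> n + n + 1"
    using half_per_fill[OF n L, of "?N - 1" c] by simp
  moreover have "Suc (?N - 1) = ?N" using N n by arith
  ultimately have "half_per L (fill_set L n c ?N) \<le> n + n + 1" by (simp only:)
  \<comment> \<open>The last site continues the bottom row, whose right end was filled at index
    \<open>n - 1\<close>.\<close>
  moreover have "\<exists>l\<in>fill_set L n c ?N. right_nb L l = fill_site L n c ?N"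
    by (rule fill_left[of n "n - 1" "n - 1" 0]) (use n N in \<open>auto simp: fill_offset_def\<close>)
  then have "half_per L (fill_set L n c (Suc ?N)) \<le> half_per L (fill_set L n c ?N) + 1"
    using half_per_insert[OF _ fill_site_new[OF n L, of ?N c], of L]
    unfolding fill_set_Suc by (simp add: fill_set_def split: if_splits)
  ultimately show ?thesis by simp
qed

text \<open>At every stage the gap to \<open>crit_energy\<close> is at least a combination of
  \<open>2 - h * n\<close>, \<open>2 - h\<close> and \<open>h\<close> with nonnegative coefficients,
  so no stage lies above the critical droplet.\<close>

lemma fill_energy:
  assumes h: "0 < h" "h * real n < 2" and n: "2 \<le> n" and L: "n + 4 < L" and i: "i \<le> n * (n + 1) + 1"
  shows "surf_energy L h (fill_set L n c i) \<le> crit_energy n h"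
proof -
  have ce: "crit_energy n h = (2 - h * real n) * (real n + 1) + (2 * real n + 2 - h)"
    by (simp add: crit_energy_def algebra_simps)
  have hn: "h * 2 \<le> h * real n" using h n by (intro mult_left_mono) auto
  consider (0) "i = 0" | (1) j where "i = Suc j" "j < n" | (2) j where "i = Suc j" "\<not> j < n" "j < n * (n + 1)"
    | (3) "i = Suc (n * (n + 1))"
    using i by (cases i) force+
  then show ?thesis
  proof cases
    case 0
    have "0 \<le> (2 - h * real n) * (real n + 1)" using h by (intro mult_nonneg_nonneg) auto
    then have "0 \<le> crit_energy n h" unfolding ce using hn h by linarith
    then show ?thesis using 0 by (simp add: fill_set_0)
  next
    case 1
    have "j < n * (n + 1)" using 1 n by (simp add: trans_less_add1)
    from half_per_fill[OF n L this, of c] have "half_per L (fill_set L n c i) \<le> j + 2" using 1 by simp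
    then have "real (half_per L (fill_set L n c i)) \<le> real j + 2" by linarith
    moreover have "card (fill_set L n c i) = Suc j" using card_fill_set[OF n L] 1 i by simp
    moreover have "h \<le> 2" using hn h by linarith
    then have "0 \<le> (2 - h) * (real n - real j)" using 1 by (intro mult_nonneg_nonneg) simp_all
    moreover have "0 \<le> real n * (2 - h * real n)" using h by (intro mult_nonneg_nonneg) simp_all
    ultimately show ?thesis by (simp add: surf_energy_def crit_energy_def algebra_simps)
  next
    case 2
    define r q where "r = j div n" and "q = j mod n"
    have "half_per L (fill_set L n c i) \<le> n + r + 1" using half_per_fill[OF n L 2(3), of c] 2(1,2) by (simp add: r_def)
    then have 1: "real (half_per L (fill_set L n c i)) \<le> real n + real r + 1" by linarith
    have "j = r * n + q" by (simp add: r_def q_def)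
    moreover have "card (fill_set L n c i) = Suc j" using card_fill_set[OF n L] 2 i by simp
    ultimately have 2: "real (card (fill_set L n c i)) = real r * real n + real q + 1" by simp
    have "r \<le> n" using \<open>j < n * (n + 1)\<close> unfolding r_def
      by (metis less_mult_imp_div_less mult.commute Suc_eq_plus1 less_Suc_eq_le)
    \<comment> \<open>The sum of these two quantities is the gap to \<open>crit_energy\<close> when
      the half perimeter attains its bound.\<close>
    then have "0 \<le> (2 - h * real n) * (real n + 1 - real r)" "0 \<le> h * real q"
      using h by (auto intro!: mult_nonneg_nonneg)
    then show ?thesis using 1 2 by (simp add: surf_energy_def crit_energy_def algebra_simps)
  next
    case 3
    have "real (half_per L (fill_set L n c i)) \<le> real (2 * n + 2)"
      using half_per_fill_last[OF n L] 3 by (intro of_nat_mono) simp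
    moreover have "card (fill_set L n c i) = Suc (n * (n + 1))" using card_fill_set[OF n L] 3 by simp
    ultimately show ?thesis by (simp add: surf_energy_def crit_energy_def algebra_simps)
  qed
qed

lemma fill_rect:
  assumes n: "2 \<le> n"
  shows "fill_set L n (a, b) (n * (n + 1)) = rect L a b n (n + 1)"
proof
  show "fill_set L n (a, b) (n * (n + 1)) \<subseteq> rect L a b n (n + 1)"
  proof
    fix x assume "x \<in> fill_set L n (a, b) (n * (n + 1))"
    then obtain i where i: "i < n * (n + 1)" "x = fill_site L n (a, b) i" by (auto simp: fill_set_def)
    then have "x = ((a + i mod n) mod L, (b + i div n) mod L)" by (simp add: fill_site_def fill_offset_def)
    moreover have "i mod n < n" using n by simp
    moreover have "i div n < n + 1" using i by (metis less_mult_imp_div_less mult.commute)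
    ultimately show "x \<in> rect L a b n (n + 1)" unfolding rect_def by blast
  qed
  show "rect L a b n (n + 1) \<subseteq> fill_set L n (a, b) (n * (n + 1))"
  proof
    fix x assume "x \<in> rect L a b n (n + 1)"
    then obtain i j where x: "x = ((a + i) mod L, (b + j) mod L)" "i < n" "j < n + 1" unfolding rect_def by blast
    have "n * j \<le> n * n" using x(3) by (intro mult_le_mono2) simp
    moreover have "n * (n + 1) = n * n + n" by simp
    ultimately have "n * j + i < n * (n + 1)" using x(2) by linarith
    moreover from this have "fill_site L n (a, b) (n * j + i) = x"
      using x by (simp add: fill_site_def fill_offset_def)
    ultimately show "x \<in> fill_set L n (a, b) (n * (n + 1))" unfolding fill_set_def by force
  qed
qed

lemma fill_end:
  assumes n: "2 \<le> n" and L: "n + 4 < L" and c: "c \<in> sites L"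
  shows "cfg L bg (fill_set L n c (n * (n + 1) + 1)) \<in> Rl_gen L n bg (bg + 1)"
proof -
  obtain a b where ab: "c = (a, b)" "a < L" "b < L" using c by (cases c) (auto simp: sites_def)
  let ?z = "fill_site L n c (n * (n + 1))"
  have rect: "fill_set L n c (n * (n + 1)) = rect L a b n (n + 1)" using fill_rect[OF n] ab by simp
  have z: "?z = ((a + n) mod L, (b + 0) mod L)" using ab by (simp add: fill_site_def fill_offset_def)
  have zl: "?z \<in> long_side_nbrs L a b n (n + 1)"
    unfolding long_side_nbrs_def z by (simp, rule disjI2, rule exI[of _ 0]) simp
  have zn: "?z \<notin> rect L a b n (n + 1)" using fill_site_new[OF n L, of "n * (n + 1)" c] rect by simp
  have "fill_set L n c (n * (n + 1) + 1) = rect L a b n (n + 1) \<union> {?z}"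
    using rect fill_set_Suc[of L n c "n * (n + 1)"] by simp
  then have "cfg L bg (fill_set L n c (n * (n + 1) + 1)) =
      (\<lambda>x. if x \<in> sites L then (if x \<in> rect L a b n (n + 1) \<union> {?z} then bg + 1 else bg) else 0)"
    by (simp only: cfg_def)
  then show ?thesis using ab zl zn unfolding Rl_gen_def by blast
qed

text \<open>The volume reveals the step \<open>i\<close>, and the site about to be filled then
  reveals the translation. Paths may share configurations, such as the background, but no
  edge.\<close>

lemma inj_fill_edges:
  assumes n: "2 \<le> n" and L: "n + 4 < L"
  shows "inj_on (\<lambda>(c, i). (cfg L bg (fill_set L n c i), fill_site L n c i)) (sites L \<times> {..<n * (n + 1) + 1})"
proof (rule inj_onI)
  fix p q :: "site \<times> nat"
  assume p: "p \<in> sites L \<times> {..<n * (n + 1) + 1}" and q: "q \<in> sites L \<times> {..<n * (n + 1) + 1}"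
    and pq: "(case p of (c, i) \<Rightarrow> (cfg L bg (fill_set L n c i), fill_site L n c i))
      = (case q of (c, i) \<Rightarrow> (cfg L bg (fill_set L n c i), fill_site L n c i))"
  obtain a b i a' b' i' where pe: "p = ((a, b), i)" "q = ((a', b'), i')" by (metis surj_pair)
  have s: "(a, b) \<in> sites L" "(a', b') \<in> sites L" and i: "i \<in> {..<n * (n + 1) + 1}" "i' \<in> {..<n * (n + 1) + 1}"
    and e: "cfg L bg (fill_set L n (a, b) i) = cfg L bg (fill_set L n (a', b') i')"
      "fill_site L n (a, b) i = fill_site L n (a', b') i'"
    using p q pq by (simp_all add: pe)
  have "fill_set L n (a, b) i = fill_set L n (a', b') i'"
    using e(1) spin_set_cfg[OF fill_set_sites] L by (metis not_less_zero gr0I)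
  then have ii: "i = i'"
    using card_fill_set[OF n L, of i "(a, b)"] card_fill_set[OF n L, of i' "(a', b')"] i by simp
  have "a = a'" "b = b'"
    using e(2) s add_mod_cancel_right[of a "fst (fill_offset n i)" L a'] add_mod_cancel_right[of b "snd (fill_offset n i)" L b']
    unfolding ii by (auto simp: fill_site_def sites_def)
  then show "p = q" using ii pe by simp
qed

subsection \<open>Counting boundary edges\<close>

lemma card_configs_supported:
  assumes U: "finite U"
  shows "card {\<sigma> \<in> configs L. spin_set L bg \<sigma> \<subseteq> U} \<le> 3 ^ card U"
proof -
  let ?C = "{\<sigma> \<in> configs L. spin_set L bg \<sigma> \<subseteq> U}"
  have "inj_on (\<lambda>\<sigma>. restrict \<sigma> U) ?C"
  proof (rule inj_onI, rule ext)
    fix \<sigma> \<tau> y assume s: "\<sigma> \<in> ?C" and t: "\<tau> \<in> ?C" and e: "restrict \<sigma> U = restrict \<tau> U"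
    show "\<sigma> y = \<tau> y"
    proof (cases "y \<in> U")
      case True
      then show ?thesis using fun_cong[OF e, of y] by simp
    next
      case False
      have "\<sigma> y = \<tau> y" if "y \<in> sites L"
      proof -
        have "y \<notin> spin_set L bg \<sigma>" "y \<notin> spin_set L bg \<tau>" using False s t by blast+
        then show ?thesis using that by (simp add: spin_set_def)
      qed
      moreover have "\<sigma> y = \<tau> y" if "y \<notin> sites L"
      proof -
        have "\<sigma> y = 0" "\<tau> y = 0" using s t that unfolding configs_def by blast+
        then show ?thesis by simp
      qed
      ultimately show ?thesis by blast
    qed
  qed
  moreover have "(\<lambda>\<sigma>. restrict \<sigma> U) ` ?C \<subseteq> PiE U (\<lambda>_. {-1, 0, 1})"
  proof (rule image_subsetI)
    fix \<sigma> assume s: "\<sigma> \<in> ?C"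
    have "\<sigma> y \<in> {-1, 0, 1}" for y
    proof (cases "y \<in> sites L")
      case False
      then have "\<sigma> y = 0" using s unfolding configs_def by blast
      then show ?thesis by simp
    qed (use s spin_values in blast)
    then show "restrict \<sigma> U \<in> PiE U (\<lambda>_. {-1, 0, 1})" by (intro restrict_PiE_iff[THEN iffD2]) blast
  qed
  ultimately have "card ?C \<le> card (PiE U (\<lambda>_. {-1, 0, 1 :: int}))"
    by (rule card_inj_on_le) (simp add: U finite_PiE)
  also have "\<dots> = 3 ^ card U" using U by (simp add: card_PiE numeral_3_eq_3)
  finally show ?thesis .
qed

definition covered :: "nat \<Rightarrow> int \<Rightarrow> nat \<Rightarrow> nat \<Rightarrow> (config \<times> site \<times> bool) set" where
  "covered L bg r k = {(\<sigma>, x, s) \<in> triples L. \<exists>xs. set xs \<subseteq> sites L \<and> length xs = k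
     \<and> insert x (spin_set L bg \<sigma>) \<subseteq> (\<Union>y\<in>set xs. nball L r y)}"

lemma finite_covered: "finite (covered L bg r k)"
  unfolding covered_def by (rule finite_subset[OF _ finite_triples[of L]]) blast

text \<open>The centres can be chosen in \<open>(L * L) ^ k\<close> ways; given them, the spins off
  the background and the flipped site are confined to a set of bounded size.\<close>

lemma card_covered:
  assumes "k \<le> m"
  shows "card (covered L bg r k) \<le> (L * L) ^ k * (3 ^ (m * 5 ^ r) * (m * 5 ^ r * 2))"
proof -
  let ?U = "\<lambda>xs. (\<Union>y\<in>set xs. nball L r y)"
  let ?X = "{xs. set xs \<subseteq> sites L \<and> length xs = k}"
  let ?T = "\<lambda>xs. {\<sigma> \<in> configs L. spin_set L bg \<sigma> \<subseteq> ?U xs} \<times> ?U xs \<times> (UNIV :: bool set)"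
  have finX: "finite ?X" by (rule finite_lists_length_eq) simp
  have finU: "finite (?U xs)" for xs by (simp add: finite_nball)
  have fin: "finite (?T xs)" for xs using finU by (simp add: finite_configs)
  have cU: "card (?U xs) \<le> m * 5 ^ r" if "xs \<in> ?X" for xs
  proof -
    have "card (?U xs) \<le> (\<Sum>y\<in>set xs. card (nball L r y))" by (rule card_UN_le) simp
    also have "\<dots> \<le> (\<Sum>y\<in>set xs. 5 ^ r)" by (rule sum_mono[OF card_nball])
    also have "\<dots> \<le> m * 5 ^ r" using that assms card_length[of xs] by simp
    finally show ?thesis .
  qed
  have cT: "card (?T xs) \<le> 3 ^ (m * 5 ^ r) * (m * 5 ^ r * 2)" if "xs \<in> ?X" for xs
  proof -
    have "card {\<sigma> \<in> configs L. spin_set L bg \<sigma> \<subseteq> ?U xs} \<le> 3 ^ card (?U xs)"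
      by (rule card_configs_supported[OF finU])
    also have "\<dots> \<le> 3 ^ (m * 5 ^ r)" using cU[OF that] by (rule power_increasing) simp
    finally have "card {\<sigma> \<in> configs L. spin_set L bg \<sigma> \<subseteq> ?U xs} * (card (?U xs) * 2) \<le> 3 ^ (m * 5 ^ r) * (m * 5 ^ r * 2)"
      using cU[OF that] by (intro mult_le_mono) simp_all
    then show ?thesis by (simp add: card_cartesian_product)
  qed
  have "covered L bg r k \<subseteq> (\<Union>xs\<in>?X. ?T xs)"
    by (auto simp: covered_def triples_def)
  then have "card (covered L bg r k) \<le> card (\<Union>xs\<in>?X. ?T xs)"
    using finX fin by (intro card_mono) blast+
  also have "\<dots> \<le> (\<Sum>xs\<in>?X. card (?T xs))" by (rule card_UN_le[OF finX])
  also have "\<dots> \<le> (\<Sum>xs\<in>?X. 3 ^ (m * 5 ^ r) * (m * 5 ^ r * 2))" by (rule sum_mono[OF cT])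
  also have "\<dots> = (L * L) ^ k * (3 ^ (m * 5 ^ r) * (m * 5 ^ r * 2))"
    using card_lists_length_eq[of "sites L" k] by simp
  finally show ?thesis .
qed

definition excess :: "nat \<Rightarrow> real \<Rightarrow> nat \<Rightarrow> real" where
  "excess n h k = (if k = 1 then min h (2 - h * real n) else 2 * (real k - 1))"

text \<open>The factor left by \<open>card_covered\<close> once the centres are chosen:
  \<open>m\<close> bounds both the volume just outside the subcritical set and the number of balls,
  \<open>m * m\<close> is their radius and \<open>b\<close> bounds the size of one ball.\<close>

definition entropy_const :: "nat \<Rightarrow> real" where
  "entropy_const n = (let m = (n + 1)\<^sup>2; b = 5 ^ (m * m) in 3 ^ (m * b) * real (m * b * 2))"

lemma sum_UN_le:
  fixes f :: "'a \<Rightarrow> real"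
  assumes "finite K" "\<And>k. k \<in> K \<Longrightarrow> finite (A k)" "\<And>x. 0 \<le> f x"
  shows "sum f (\<Union>k\<in>K. A k) \<le> (\<Sum>k\<in>K. sum f (A k))"
  using assms(1,2)
proof (induction K rule: finite_induct)
  case (insert k K)
  have "sum f (A k \<union> (\<Union>j\<in>K. A j)) + sum f (A k \<inter> (\<Union>j\<in>K. A j)) = sum f (A k) + sum f (\<Union>j\<in>K. A j)"
    using insert by (intro sum.union_inter) auto
  moreover have "0 \<le> sum f (A k \<inter> (\<Union>j\<in>K. A j))" using assms(3) by (simp add: sum_nonneg)
  moreover have "sum f (\<Union>j\<in>K. A j) \<le> (\<Sum>j\<in>K. sum f (A j))" using insert by simp
  ultimately show ?case using insert.hyps by simp
qed simp

lemma boundary_weight: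
  assumes h: "0 < h" "h < 1" "h * real n < 2" and n: "2 \<le> n" and L: "n * (n + 1) + 2 \<le> L"
    and bg: "bg \<in> {-1, 0}" and \<beta>: "0 < \<beta>"
  shows "(\<Sum>(\<sigma>, x, s)\<in>{(\<sigma>, x, s) \<in> triples L. subcritical n (spin_set L bg \<sigma>)
             \<and> \<not> subcritical n (spin_set L bg (flip s x \<sigma>)) \<and> flip s x \<sigma> \<notin> Rl_gen L n bg (bg + 1)}.
           wt L h \<beta> \<sigma> (flip s x \<sigma>))
    \<le> exp (- \<beta> * (Ham L h (const_cfg L bg) + crit_energy n h)) * entropy_const n *
        (\<Sum>k\<in>{1..(n + 1)\<^sup>2}. real (L * L) ^ k * exp (- \<beta> * excess n h k))"
proof -
  define m where "m = (n + 1)\<^sup>2"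
  define E where "E = Ham L h (const_cfg L bg) + crit_energy n h"
  let ?D = "{(\<sigma>, x, s) \<in> triples L. subcritical n (spin_set L bg \<sigma>)
             \<and> \<not> subcritical n (spin_set L bg (flip s x \<sigma>)) \<and> flip s x \<sigma> \<notin> Rl_gen L n bg (bg + 1)}"
  let ?w = "\<lambda>(\<sigma>, x, s). wt L h \<beta> \<sigma> (flip s x \<sigma>)"
  \<comment> \<open>An edge can be covered by various numbers of balls, and the energy bound is
    known only for the number found below; hence it is made part of \<open>?K k\<close>.\<close>
  let ?K = "\<lambda>k. {t \<in> covered L bg (m * m) k. ?w t \<le> exp (- \<beta> * (E + excess n h k))}"
  have "?D \<subseteq> (\<Union>k\<in>{1..m}. ?K k)"
  proof (rule subsetI)
    fix t assume t: "t \<in> ?D"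
    obtain \<sigma> x s where te: "t = (\<sigma>, x, s)" by (cases t)
    have d: "\<sigma> \<in> configs L" "x \<in> sites L" "subcritical n (spin_set L bg \<sigma>)"
      "\<not> subcritical n (spin_set L bg (flip s x \<sigma>))" "flip s x \<sigma> \<notin> Rl_gen L n bg (bg + 1)"
      using t unfolding te by (auto simp: triples_def)
    obtain xs where xs: "set xs \<subseteq> sites L"
      "insert x (spin_set L bg \<sigma>) \<subseteq> (\<Union>y\<in>set xs. nball L (m * m) y)"
      "1 \<le> length xs" "length xs \<le> m"
      "crit_energy n h + excess n h (length xs)
        \<le> max (Ham L h \<sigma>) (Ham L h (flip s x \<sigma>)) - Ham L h (const_cfg L bg)"
      using boundary_triple[OF h n L bg d] unfolding m_def excess_def by blast
    have "t \<in> covered L bg (m * m) (length xs)"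
      unfolding covered_def te using xs(1,2) d(1,2) by (auto simp: triples_def)
    moreover have "\<beta> * (E + excess n h (length xs)) \<le> \<beta> * max (Ham L h \<sigma>) (Ham L h (flip s x \<sigma>))"
      using xs(5) \<beta> unfolding E_def by (intro mult_left_mono) auto
    then have "?w t \<le> exp (- \<beta> * (E + excess n h (length xs)))" unfolding te wt_def by simp
    ultimately show "t \<in> (\<Union>k\<in>{1..m}. ?K k)" using xs(3,4) by auto
  qed
  then have "sum ?w ?D \<le> sum ?w (\<Union>k\<in>{1..m}. ?K k)"
    by (intro sum_mono2) (auto simp: finite_covered less_imp_le[OF wt_pos])
  also have "\<dots> \<le> (\<Sum>k\<in>{1..m}. sum ?w (?K k))"
    by (rule sum_UN_le) (auto simp: finite_covered less_imp_le[OF wt_pos])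
  also have "\<dots> \<le> (\<Sum>k\<in>{1..m}. real (L * L) ^ k * entropy_const n * exp (- \<beta> * (E + excess n h k)))"
  proof (rule sum_mono)
    fix k assume "k \<in> {1..m}"
    then have k: "k \<le> m" by simp
    have "sum ?w (?K k) \<le> (\<Sum>t\<in>?K k. exp (- \<beta> * (E + excess n h k)))"
      by (rule sum_mono) simp
    also have "\<dots> = real (card (?K k)) * exp (- \<beta> * (E + excess n h k))" by simp
    also have "\<dots> \<le> (real (L * L) ^ k * entropy_const n) * exp (- \<beta> * (E + excess n h k))"
    proof (rule mult_right_mono)
      have "card (?K k) \<le> card (covered L bg (m * m) k)"
        by (rule card_mono[OF finite_covered]) blast
      also have "\<dots> \<le> (L * L) ^ k * (3 ^ (m * 5 ^ (m * m)) * (m * 5 ^ (m * m) * 2))"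
        by (rule card_covered[OF k])
      finally have "real (card (?K k)) \<le> real ((L * L) ^ k * (3 ^ (m * 5 ^ (m * m)) * (m * 5 ^ (m * m) * 2)))"
        by (rule of_nat_mono)
      also have "\<dots> = real (L * L) ^ k * entropy_const n"
        unfolding entropy_const_def Let_def m_def[symmetric] by (simp only: of_nat_mult of_nat_power of_nat_numeral)
      finally show "real (card (?K k)) \<le> real (L * L) ^ k * entropy_const n" .
    qed simp
    finally show "sum ?w (?K k) \<le> real (L * L) ^ k * entropy_const n * exp (- \<beta> * (E + excess n h k))" .
  qed
  also have "\<dots> = exp (- \<beta> * E) * entropy_const n * (\<Sum>k\<in>{1..m}. real (L * L) ^ k * exp (- \<beta> * excess n h k))"
    unfolding sum_distrib_left by (rule sum.cong) (simp_all only: distrib_left exp_add mult_ac)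
  finally show ?thesis unfolding m_def E_def .
qed

section \<open>The bound on the missing probability and its limit\<close>

lemma const_not_subcritical:
  assumes n: "2 \<le> n" and L: "n * (n + 1) + 2 \<le> L" and c: "c \<noteq> bg"
  shows "\<not> subcritical n (spin_set L bg (const_cfg L c))"
proof -
  have nL: "n + 4 < L" by (rule torus_large[OF n L])
  have s: "spin_set L bg (const_cfg L c) = sites L" using c by (auto simp: spin_set_def const_cfg_def)
  have "fst ` sites L = {0..<L}" "snd ` sites L = {0..<L}" using nL by (auto simp: sites_def fst_image_times snd_image_times)
  moreover have "n * (n + 1) < L * L" 
  proof -
    have "L * 1 \<le> L * L" using nL by (intro mult_le_mono2) simp
    then show ?thesis using L by linarith
  qed
  ultimately show ?thesis unfolding s subcritical_def small_box_def using nL by simp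
qed

lemma const_not_critical:
  assumes "2 \<le> n" "0 < L"
  shows "const_cfg L bg \<notin> Rl_gen L n bg (bg + 1)"
proof
  assume "const_cfg L bg \<in> Rl_gen L n bg (bg + 1)"
  then obtain a b w ht z where r: "a < L" "b < L" "w = n \<and> ht = n + 1 \<or> w = n + 1 \<and> ht = n"
    "const_cfg L bg = (\<lambda>x. if x \<in> sites L then (if x \<in> rect L a b w ht \<union> {z} then bg + 1 else bg) else 0)"
    unfolding Rl_gen_def by blast
  have ab: "(a, b) \<in> sites L" using r by (simp add: sites_def)
  have "(a, b) = ((a + 0) mod L, (b + 0) mod L)" "0 < w" "0 < ht" using r(1-3) assms by auto
  then have "(a, b) \<in> rect L a b w ht" unfolding rect_def by blast
  then show False using fun_cong[OF r(4), of "(a, b)"] ab by (simp add: const_cfg_def)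
qed

lemma miss_bound:
  assumes h: "0 < h" "h < 1" "h * real n < 2" and n: "2 \<le> n" and L: "n * (n + 1) + 2 \<le> L"
    and bg: "bg \<in> {-1, 0}" and \<beta>: "0 < \<beta>" and B: "B \<subseteq> {const_cfg L c | c. c \<noteq> bg}"
  shows "(1 - hit_before L h \<beta> (Rl_gen L n bg (bg + 1)) B (const_cfg L bg))\<^sup>2
    \<le> 2 * (real n * (real n + 1) + 1) * entropy_const n *
       (exp (- \<beta> * min h (2 - h * real n)) + (\<Sum>k\<in>{2..(n + 1)\<^sup>2}. (real (L * L) * exp (- 2 * \<beta>)) ^ (k - 1)))"
proof -
  let ?A = "Rl_gen L n bg (bg + 1)" and ?x0 = "const_cfg L bg"
  define S where "S \<sigma> \<longleftrightarrow> subcritical n (spin_set L bg \<sigma>)" for \<sigma>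
  define g where "g = miss L h \<beta> ?A B"
  define \<phi> where "\<phi> \<sigma> = (if S \<sigma> then g \<sigma> else 0)" for \<sigma>
  define N where "N = n * (n + 1) + 1"
  define E where "E = Ham L h ?x0 + crit_energy n h"
  define Z where "Z = (\<Sum>k\<in>{1..(n + 1)\<^sup>2}. real (L * L) ^ k * exp (- \<beta> * excess n h k))"
  have nL: "n + 4 < L" by (rule torus_large[OF n L])
  then have L0: "0 < L" by simp
  have SB: "\<not> S \<sigma>" if "\<sigma> \<in> B" for \<sigma>
    using that B const_not_subcritical[OF n L] unfolding S_def by blast
  have sx0: "spin_set L bg ?x0 = {}" by (auto simp: spin_set_def const_cfg_def)
  have Sx0: "S ?x0" unfolding S_def sx0 by (simp add: subcritical_def)
  have "?x0 \<notin> ?A" by (rule const_not_critical[OF n L0])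
  moreover have "?x0 \<notin> B" using SB Sx0 by blast
  ultimately have gx0: "g ?x0 = 1 - hit_before L h \<beta> ?A B ?x0" by (simp add: g_def miss_def)
  let ?P = "\<lambda>c i. cfg L bg (fill_set L n c i)"
  have Pstep: "?P c (Suc i) = flip True (fill_site L n c i) (?P c i)" if "i < N" for c i
    unfolding fill_set_Suc
    by (rule flip_cfg[OF bg fill_site_sites[OF L0] fill_site_new[OF n nL], symmetric]) (use that in \<open>simp add: N_def\<close>)
  have HP: "Ham L h (?P c i) \<le> E" if "i \<le> N" for c i
    using Ham_cfg[OF fill_set_sites[OF L0], of h bg n c i] fill_energy[OF h(1,3) n nL, of i c] that
    unfolding E_def N_def by linarith
  have "real (card (sites L)) * exp (- \<beta> * E) * (g ?x0)\<^sup>2 \<le> real N *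
    (\<Sum>(\<sigma>, x, s)\<in>triples L. wt L h \<beta> \<sigma> (flip s x \<sigma>) * (\<phi> (flip s x \<sigma>) - \<phi> \<sigma>)\<^sup>2)"
  proof (rule path_bound[where P = ?P and z = "fill_site L n"])
    show "0 < N" by (simp add: N_def)
    show "?P c (Suc i) = flip True (fill_site L n c i) (?P c i)" if "i < N" for c i by (rule Pstep[OF that])
    show "?P c i \<in> configs L \<and> fill_site L n c i \<in> sites L" for c i
      using cfg_configs[OF bg] fill_site_sites[OF L0] by blast
    show "inj_on (\<lambda>(c, i). (?P c i, fill_site L n c i)) (sites L \<times> {..<N})"
      unfolding N_def by (rule inj_fill_edges[OF n nL])
    show "exp (- \<beta> * E) \<le> wt L h \<beta> (?P c i) (?P c (Suc i))" if "i < N" for c i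
      using HP[of i c] HP[of "Suc i" c] that \<beta> by (simp add: wt_def)
    show "\<phi> (?P c 0) = g ?x0 \<and> \<phi> (?P c N) = 0" if "c \<in> sites L" for c
      using fill_end[OF n nL that, of bg] Sx0
      by (simp add: fill_set_0 cfg_empty \<phi>_def N_def g_def miss_def)
  qed simp_all
  also have "\<dots> \<le> real N * (2 * (\<Sum>(\<sigma>, x, s)\<in>{(\<sigma>, x, s) \<in> triples L. S \<sigma> \<and> \<not> S (flip s x \<sigma>) \<and> flip s x \<sigma> \<notin> ?A}.
       wt L h \<beta> \<sigma> (flip s x \<sigma>)))"
    unfolding \<phi>_def g_def by (intro mult_left_mono dirichlet_bound[OF L0 SB]) simp_all
  also have "\<dots> \<le> real N * (2 * (exp (- \<beta> * E) * entropy_const n * Z))"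
    unfolding S_def E_def Z_def by (intro mult_left_mono boundary_weight[OF h n L bg \<beta>]) simp_all
  finally have "exp (- \<beta> * E) * (real (L * L) * (g ?x0)\<^sup>2) \<le> exp (- \<beta> * E) * (2 * real N * entropy_const n * Z)"
    by (simp add: mult_ac)
  then have main: "real (L * L) * (g ?x0)\<^sup>2 \<le> 2 * real N * entropy_const n * Z"
    by (simp only: mult_le_cancel_left_pos exp_gt_zero)
  \<comment> \<open>One factor \<open>L * L\<close> is taken out of every term, to be cancelled
    against the number of paths.\<close>
  have Zsplit: "Z = real (L * L) * (exp (- \<beta> * min h (2 - h * real n)) + (\<Sum>k\<in>{2..(n + 1)\<^sup>2}. (real (L * L) * exp (- 2 * \<beta>)) ^ (k - 1)))"
  proof -
    have "{1..(n + 1)\<^sup>2} = insert 1 {2..(n + 1)\<^sup>2}" by auto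
    then have "Z = real (L * L) * exp (- \<beta> * excess n h 1) + (\<Sum>k\<in>{2..(n + 1)\<^sup>2}. real (L * L) ^ k * exp (- \<beta> * excess n h k))"
      unfolding Z_def by simp
    also have "(\<Sum>k\<in>{2..(n + 1)\<^sup>2}. real (L * L) ^ k * exp (- \<beta> * excess n h k))
        = (\<Sum>k\<in>{2..(n + 1)\<^sup>2}. real (L * L) * (real (L * L) * exp (- 2 * \<beta>)) ^ (k - 1))"
    proof (rule sum.cong[OF refl])
      fix k assume "k \<in> {2..(n + 1)\<^sup>2}"
      then obtain j where k: "k = Suc j" "0 < j" by (cases k) auto
      have "exp (- \<beta> * excess n h k) = exp (- 2 * \<beta>) ^ j"
        using k by (simp add: excess_def exp_of_nat_mult[symmetric] mult_ac)
      then show "real (L * L) ^ k * exp (- \<beta> * excess n h k) = real (L * L) * (real (L * L) * exp (- 2 * \<beta>)) ^ (k - 1)"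
        using k by (simp only: power_mult_distrib power_Suc diff_Suc_1 mult.assoc)
    qed
    finally show ?thesis by (simp only: excess_def if_True refl distrib_left sum_distrib_left)
  qed
  have LL: "0 < real (L * L)" using L0 by simp
  have Nr: "real N = real n * (real n + 1) + 1" by (simp add: N_def algebra_simps)
  have "real (L * L) * (g ?x0)\<^sup>2 \<le> real (L * L) * (2 * real N * entropy_const n *
     (exp (- \<beta> * min h (2 - h * real n)) + (\<Sum>k\<in>{2..(n + 1)\<^sup>2}. (real (L * L) * exp (- 2 * \<beta>)) ^ (k - 1))))"
    using main unfolding Zsplit by (simp only: mult_ac)
  then have "(g ?x0)\<^sup>2 \<le> 2 * real N * entropy_const n *
     (exp (- \<beta> * min h (2 - h * real n)) + (\<Sum>k\<in>{2..(n + 1)\<^sup>2}. (real (L * L) * exp (- 2 * \<beta>)) ^ (k - 1)))"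
    using LL by (simp only: mult_le_cancel_left_pos)
  then show ?thesis unfolding gx0 Nr .
qed

text \<open>The bound on the squared missing probability vanishes term by term:
  \<open>\<delta>\<close> is positive, and the powers of |\<Lambda>| exp(-2\<beta>) have exponents
  \<open>k - 1 >= 1\<close>. Their number depends only on \<open>n\<close>.\<close>

lemma hit_limit:
  fixes L :: "real \<Rightarrow> nat"
  assumes h: "0 < h" "h < 1" "h * real n < 2" and n: "2 \<le> n"
    and L: "\<And>\<beta>. \<beta> > 0 \<Longrightarrow> n * (n + 1) + 2 \<le> L \<beta>"
    and lim: "((\<lambda>\<beta>. real (card (sites (L \<beta>))) * exp (- 2 * \<beta>)) \<longlongrightarrow> 0) at_top"
    and bg: "bg \<in> {-1, 0}" and B: "\<And>\<beta>. B \<beta> \<subseteq> {const_cfg (L \<beta>) c | c. c \<noteq> bg}"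
  shows "((\<lambda>\<beta>. hit_before (L \<beta>) h \<beta> (Rl_gen (L \<beta>) n bg (bg + 1)) (B \<beta>) (const_cfg (L \<beta>) bg)) \<longlongrightarrow> 1) at_top"
proof -
  define \<delta> where "\<delta> = min h (2 - h * real n)"
  let ?C = "2 * (real n * (real n + 1) + 1) * entropy_const n"
  let ?b = "\<lambda>\<beta>. ?C * (exp (- \<beta> * \<delta>) + (\<Sum>k\<in>{2..(n + 1)\<^sup>2}. (real (L \<beta> * L \<beta>) * exp (- 2 * \<beta>)) ^ (k - 1)))"
  let ?G = "\<lambda>\<beta>. 1 - hit_before (L \<beta>) h \<beta> (Rl_gen (L \<beta>) n bg (bg + 1)) (B \<beta>) (const_cfg (L \<beta>) bg)"
  have \<delta>: "0 < \<delta>" using h by (simp add: \<delta>_def)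
  have "((\<lambda>\<beta>::real. exp (- \<beta> * \<delta>)) \<longlongrightarrow> 0) at_top"
    using \<delta> by real_asymp
  moreover have "((\<lambda>\<beta>. (real (L \<beta> * L \<beta>) * exp (- 2 * \<beta>)) ^ (k - 1)) \<longlongrightarrow> 0) at_top" if "k \<in> {2..(n + 1)\<^sup>2}" for k
    using tendsto_power[OF lim, of "k - 1"] that by (simp add: power_0_left)
  ultimately have "(?b \<longlongrightarrow> ?C * (0 + (\<Sum>k\<in>{2..(n + 1)\<^sup>2}. 0))) at_top"
    by (intro tendsto_mult tendsto_add tendsto_sum tendsto_const)
  then have b0: "(?b \<longlongrightarrow> 0) at_top" by simp
  have "eventually (\<lambda>\<beta>. (?G \<beta>)\<^sup>2 \<le> ?b \<beta>) at_top"
    using eventually_gt_at_top[of 0]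
  proof eventually_elim
    case (elim \<beta>)
    show ?case unfolding \<delta>_def by (rule miss_bound[OF h n L[OF elim] bg elim B])
  qed
  then have "((\<lambda>\<beta>. (?G \<beta>)\<^sup>2) \<longlongrightarrow> 0) at_top"
    by (intro tendsto_sandwich[OF _ _ tendsto_const b0]) simp_all
  then have "(?G \<longlongrightarrow> 0) at_top" by simp
  then have "((\<lambda>\<beta>. 1 - ?G \<beta>) \<longlongrightarrow> 1 - 0) at_top" by (intro tendsto_diff tendsto_const)
  then show ?thesis by simp
qed

theorem theorem2p1:
  fixes h :: real and L :: "real \<Rightarrow> nat"
  assumes "0 < h" and "h < 1"
    and "\<not> (\<exists>k::int. 2 / h = of_int k)"
    and "\<And>\<beta>. \<beta> > 0 \<Longrightarrow> L \<beta> \<ge> n0_of h * (n0_of h + 1) + 2"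
    and "((\<lambda>\<beta>. real (card (sites (L \<beta>))) * exp (- 2 * \<beta>)) \<longlongrightarrow> 0) at_top"
  shows "((\<lambda>\<beta>. hit_before (L \<beta>) h \<beta> (Rl (L \<beta>) (n0_of h))
              {const_cfg (L \<beta>) 0, const_cfg (L \<beta>) 1} (const_cfg (L \<beta>) (-1))) \<longlongrightarrow> 1) at_top \<and>
         ((\<lambda>\<beta>. hit_before (L \<beta>) h \<beta> (Rl0 (L \<beta>) (n0_of h))
              {const_cfg (L \<beta>) (-1), const_cfg (L \<beta>) 1} (const_cfg (L \<beta>) 0)) \<longlongrightarrow> 1) at_top"
proof -
  have "2 < 2 / h" using assms(1,2) by (simp add: divide_simps)
  then have fl: "2 \<le> \<lfloor>2 / h\<rfloor>" by linarith
  then have n: "2 \<le> n0_of h" unfolding n0_of_def by linarith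
  have "real (n0_of h) = of_int \<lfloor>2 / h\<rfloor>" unfolding n0_of_def using fl by linarith
  \<comment> \<open>Since \<open>2 / h\<close> is not an integer, the floor lies strictly below it,
    which makes the margin \<open>2 - h * n\<close> positive.\<close>
  moreover have "of_int \<lfloor>2 / h\<rfloor> \<noteq> 2 / h" using assms(3) by metis
  ultimately have "real (n0_of h) < 2 / h" using of_int_floor_le[of "2 / h"] by linarith
  then have hn: "h * real (n0_of h) < 2" using assms(1) by (simp add: divide_simps mult.commute)
  have "((\<lambda>\<beta>. hit_before (L \<beta>) h \<beta> (Rl_gen (L \<beta>) (n0_of h) (-1) (-1 + 1))
              {const_cfg (L \<beta>) 0, const_cfg (L \<beta>) 1} (const_cfg (L \<beta>) (-1))) \<longlongrightarrow> 1) at_top"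
    by (rule hit_limit[OF assms(1,2) hn n assms(4,5)]) force+
  moreover have "((\<lambda>\<beta>. hit_before (L \<beta>) h \<beta> (Rl_gen (L \<beta>) (n0_of h) 0 (0 + 1))
              {const_cfg (L \<beta>) (-1), const_cfg (L \<beta>) 1} (const_cfg (L \<beta>) 0)) \<longlongrightarrow> 1) at_top"
    by (rule hit_limit[OF assms(1,2) hn n assms(4,5)]) force+
  ultimately show ?thesis by (simp add: Rl_def Rl0_def)
qed

end
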